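(* Let $d=(d_n)_{n\ge0}$ be a monotonic increasing, unbounded sequence of positive real numbers such that $\lim_{n\to\infty}\frac{d_{n+1}}{d_n}=r$ for some real number $r$. Let $a=(a_n)_{n\ge0}$ be a complex sequence with $a_0\ne0$, $a_1\neq0$ such that $T_a$ is a bounded linear operator on $h_d$ and such that the power series $\Phi_a(z)=\sum_{n=0}^\infty a_nz^n$ is analytic on some neighbourhood of $\overline{\mathbb D}_r$. Then: (i) If $r=1$, then $$\sigma_r(T_a,h_d)=\sigma_p(T_a^*,h_d^* )=\begin{cases}\Phi_a(\overline{\mathbb D}), & \text{if } \sup_n\frac{n+1}{d_n}<\infty,\\ \Phi_a(\overline{\mathbb D}\setminus\{1\}), & \text{if } \sup_n\frac{n+1}{d_n}=\infty.\end{cases}$$ (ii) If $r>1$, then $$\sigma_r(T_a,h_d)=\sigma_p(T_a^*,h_d^* )=\begin{cases}\Phi_a(\overline{\mathbb D}_r), & \text{if } \sup_n\frac{r^n}{d_n}<\infty,\\ \Phi_a(\mathbb D_r), & \text{if } \sup_n\frac{r^n}{d_n}=\infty.\end{cases}$$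
   Context: All sequences are complex and indexed by $\mathbb N_0=\{0,1,2,\dots\}$. The weighted Hahn space is $h_d=\{x\in\mathbb C^{\mathbb N_0}:\sum_{n=0}^\infty d_n|x_n-x_{n+1}|<\infty,\ \lim_n x_n=0\}$ with norm $\|x\|_{h_d}=\sum_{n=0}^\infty d_n|x_n-x_{n+1}|$; it is a Banach space. Its continuous dual $h_d^*$ is isometrically identified, via $x\mapsto\sum_k x_ky_k$, with $bs_d=\{y\in\mathbb C^{\mathbb N_0}:\sup_m\frac1{d_m}|\sum_{k=0}^m y_k|<\infty\}$. The convolution is $(a*x)_n=\sum_{k=0}^n a_{n-k}x_k$, and $T_a(x)=a*x$. $T_a^*$ is the Banach space adjoint, $(T_a^*\zeta)(x)=\zeta(T_ax)$. $\mathbb D_r$ is the open disk in $\mathbb C$ centered at $0$ of radius $r$, $\overline{\mathbb D}_r$ its closure, $\mathbb D=\mathbb D_1$. $\Phi_a$ being analytic on a neighbourhood of $\overline{\mathbb D}_r$ means the power series converges there to an analytic function. For $T\in\mathcal B(X)$: $\sigma_p(T,X)$ is the set of $\lambda$ with $T-\lambda I$ not injective; the residual spectrum $\sigma_r(T,X)$ is the set of $\lambda$ with $T-\lambda I$ injective and $\overline{\mathcal R(T-\lambda I)}\ne X$, where $\mathcal R$ denotes the range (the subscript in $\sigma_r$ is unrelated to the number $r$). *)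

theory Defs
  imports "HOL-Complex_Analysis.Complex_Analysis"
begin

text \<open>
  The space \<open>h\<^sub>d\<close> depends on the sequence \<open>d\<close>, so it is a carrier set together with a norm
  rather than a type. In general, a normed space here is a set \<open>X\<close> of complex functions
  with the pointwise operations, and a norm \<open>N\<close> on it. Taking sequences as the functions gives
  \<open>h\<^sub>d\<close>; taking functions on \<open>h\<^sub>d\<close> gives its dual.
\<close>

definition bounded_op ::
  "('i \<Rightarrow> complex) set \<Rightarrow> (('i \<Rightarrow> complex) \<Rightarrow> real) \<Rightarrow> (('i \<Rightarrow> complex) \<Rightarrow> ('i \<Rightarrow> complex)) \<Rightarrow> bool"
  where "bounded_op X N T \<longleftrightarrow>
    (\<forall>x\<in>X. T x \<in> X) \<and>
    (\<forall>x\<in>X. \<forall>y\<in>X. T (\<lambda>i. x i + y i) = (\<lambda>i. T x i + T y i)) \<and>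
    (\<forall>c. \<forall>x\<in>X. T (\<lambda>i. c * x i) = (\<lambda>i. c * T x i)) \<and>
    (\<exists>C. \<forall>x\<in>X. N (T x) \<le> C * N x)"

text \<open>Functionals on \<open>X\<close> are extended by \<open>0\<close> outside \<open>X\<close>, so that equality of functionals
  is equality on \<open>X\<close>.\<close>

definition cont_dual ::
  "('i \<Rightarrow> complex) set \<Rightarrow> (('i \<Rightarrow> complex) \<Rightarrow> real) \<Rightarrow> (('i \<Rightarrow> complex) \<Rightarrow> complex) set"
  where "cont_dual X N = {f.
    (\<forall>x. x \<notin> X \<longrightarrow> f x = 0) \<and>
    (\<forall>x\<in>X. \<forall>y\<in>X. f (\<lambda>i. x i + y i) = f x + f y) \<and>
    (\<forall>c. \<forall>x\<in>X. f (\<lambda>i. c * x i) = c * f x) \<and>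
    (\<exists>C. \<forall>x\<in>X. cmod (f x) \<le> C * N x)}"

definition adjoint_op ::
  "('i \<Rightarrow> complex) set \<Rightarrow> (('i \<Rightarrow> complex) \<Rightarrow> ('i \<Rightarrow> complex)) \<Rightarrow>
   (('i \<Rightarrow> complex) \<Rightarrow> complex) \<Rightarrow> (('i \<Rightarrow> complex) \<Rightarrow> complex)"
  where "adjoint_op X T f = (\<lambda>x. if x \<in> X then f (T x) else 0)"

definition shift_op ::
  "(('i \<Rightarrow> complex) \<Rightarrow> ('i \<Rightarrow> complex)) \<Rightarrow> complex \<Rightarrow> ('i \<Rightarrow> complex) \<Rightarrow> ('i \<Rightarrow> complex)"
  where "shift_op T l x = (\<lambda>i. T x i - l * x i)"

definition point_spectrum ::
  "('i \<Rightarrow> complex) set \<Rightarrow> (('i \<Rightarrow> complex) \<Rightarrow> ('i \<Rightarrow> complex)) \<Rightarrow> complex set"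
  where "point_spectrum X T = {l. \<not> inj_on (shift_op T l) X}"

definition norm_topology ::
  "('i \<Rightarrow> complex) set \<Rightarrow> (('i \<Rightarrow> complex) \<Rightarrow> real) \<Rightarrow> ('i \<Rightarrow> complex) topology"
  where "norm_topology X N = Metric_space.mtopology X (\<lambda>x y. N (\<lambda>i. x i - y i))"

definition residual_spectrum ::
  "('i \<Rightarrow> complex) set \<Rightarrow> (('i \<Rightarrow> complex) \<Rightarrow> real) \<Rightarrow>
   (('i \<Rightarrow> complex) \<Rightarrow> ('i \<Rightarrow> complex)) \<Rightarrow> complex set"
  where "residual_spectrum X N T =
    {l. inj_on (shift_op T l) X \<and> norm_topology X N closure_of (shift_op T l ` X) \<noteq> X}"

definition hahn :: "(nat \<Rightarrow> real) \<Rightarrow> (nat \<Rightarrow> complex) set"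
  where "hahn d = {x. summable (\<lambda>n. d n * cmod (x n - x (Suc n))) \<and> x \<longlonglongrightarrow> 0}"

text \<open>The value \<open>0\<close> outside \<open>hahn d\<close> is immaterial; it is there because the locale
  \<^locale>\<open>Metric_space\<close> wants a nonnegative distance on the whole type.\<close>

definition hahn_norm :: "(nat \<Rightarrow> real) \<Rightarrow> (nat \<Rightarrow> complex) \<Rightarrow> real"
  where "hahn_norm d x = (if x \<in> hahn d then \<Sum>n. d n * cmod (x n - x (Suc n)) else 0)"

definition conv_op :: "(nat \<Rightarrow> complex) \<Rightarrow> (nat \<Rightarrow> complex) \<Rightarrow> (nat \<Rightarrow> complex)"
  where "conv_op a x = (\<lambda>n. \<Sum>k\<le>n. a (n - k) * x k)"

definition power_series :: "(nat \<Rightarrow> complex) \<Rightarrow> complex \<Rightarrow> complex"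
  where "power_series a z = (\<Sum>n. a n * z ^ n)"

lemma hahn_add:
  assumes d: "\<And>n. 0 < d n" and x: "x \<in> hahn d" and y: "y \<in> hahn d"
  shows "(\<lambda>n. x n + y n) \<in> hahn d"
    and "hahn_norm d (\<lambda>n. x n + y n) \<le> hahn_norm d x + hahn_norm d y"
proof -
  let ?f = "\<lambda>x n. d n * cmod (x n - x (Suc n))"
  have sx: "summable (?f x)" and sy: "summable (?f y)"
    using x y by (auto simp: hahn_def)
  have le: "?f (\<lambda>n. x n + y n) n \<le> ?f x n + ?f y n" for n
  proof -
    have "cmod (x n + y n - (x (Suc n) + y (Suc n)))
        \<le> cmod (x n - x (Suc n)) + cmod (y n - y (Suc n))"
      using norm_triangle_ineq[of "x n - x (Suc n)" "y n - y (Suc n)"]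
      by (simp add: algebra_simps)
    then show ?thesis
      using d[of n] by (simp flip: distrib_left)
  qed
  have s: "summable (?f (\<lambda>n. x n + y n))"
    using d le by (intro summable_comparison_test'[OF summable_add[OF sx sy]])
      (auto simp: less_imp_le abs_mult)
  show mem: "(\<lambda>n. x n + y n) \<in> hahn d"
    using s x y tendsto_add[of x 0 sequentially y 0] by (auto simp: hahn_def)
  show "hahn_norm d (\<lambda>n. x n + y n) \<le> hahn_norm d x + hahn_norm d y"
    using suminf_le[OF le s summable_add[OF sx sy]] suminf_add[OF sx sy] mem x y
    by (simp add: hahn_norm_def)
qed

lemma hahn_scale:
  assumes x: "x \<in> hahn d"
  shows "(\<lambda>n. c * x n) \<in> hahn d"
    and "hahn_norm d (\<lambda>n. c * x n) = cmod c * hahn_norm d x"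
proof -
  have eq: "d n * cmod (c * x n - c * x (Suc n)) = cmod c * (d n * cmod (x n - x (Suc n)))" for n
    by (simp add: norm_mult flip: right_diff_distrib)
  show mem: "(\<lambda>n. c * x n) \<in> hahn d"
    using x unfolding hahn_def mem_Collect_eq eq
    by (auto intro: summable_mult tendsto_mult_right_zero)
  show "hahn_norm d (\<lambda>n. c * x n) = cmod c * hahn_norm d x"
    using mem x unfolding hahn_norm_def eq by (simp add: suminf_mult hahn_def)
qed

lemma hahn_norm_nonneg:
  assumes d: "\<And>n. 0 < d n"
  shows "0 \<le> hahn_norm d x"
  using d by (auto simp: hahn_norm_def hahn_def less_imp_le intro!: suminf_nonneg)

lemma hahn_norm_eq_0:
  assumes d: "\<And>n. 0 < d n" and x: "x \<in> hahn d" and 0: "hahn_norm d x = 0"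
  shows "x n = 0"
proof -
  have "\<forall>n. d n * cmod (x n - x (Suc n)) = 0"
    using suminf_eq_zero_iff[of "\<lambda>n. d n * cmod (x n - x (Suc n))"] x 0 d
    by (auto simp: hahn_norm_def hahn_def less_imp_le)
  moreover have "d n \<noteq> 0" for n
    using d[of n] by simp
  ultimately have Suc: "x (Suc n) = x n" for n
    by simp
  have const: "x n = x 0" for n
    by (induction n) (simp_all add: Suc)
  have "x \<longlonglongrightarrow> 0"
    using x by (simp add: hahn_def)
  moreover have "x \<longlonglongrightarrow> x 0"
    by (rule Lim_transform_eventually[OF tendsto_const])
      (rule always_eventually, rule allI, rule const[symmetric])
  ultimately have "x 0 = 0"
    by (rule LIMSEQ_unique[symmetric])
  then show ?thesis
    by (simp add: const[of n])
qed

lemma Metric_space_hahn: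
  assumes d: "\<And>n. 0 < d n"
  shows "Metric_space (hahn d) (\<lambda>x y. hahn_norm d (\<lambda>n. x n - y n))"
proof
  have diff: "(\<lambda>n. x n - y n) \<in> hahn d" if "x \<in> hahn d" "y \<in> hahn d" for x y
    using hahn_add(1)[OF d that(1) hahn_scale(1)[OF that(2), of "-1"]] by simp
  fix x y z :: "nat \<Rightarrow> complex"
  show "0 \<le> hahn_norm d (\<lambda>n. x n - y n)"
    by (rule hahn_norm_nonneg[OF d])
  have "(\<lambda>n. u n - v n) \<in> hahn d" if "(\<lambda>n. v n - u n) \<in> hahn d" for u v
    using hahn_scale(1)[OF that, of "-1"] by simp
  then have "(\<lambda>n. x n - y n) \<in> hahn d \<longleftrightarrow> (\<lambda>n. y n - x n) \<in> hahn d" by blast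
  moreover have "cmod (x n - y n - (x (Suc n) - y (Suc n)))
      = cmod (y n - x n - (y (Suc n) - x (Suc n)))" for n
    using norm_minus_commute[of "x n - y n" "x (Suc n) - y (Suc n)"]
    by (simp add: algebra_simps)
  ultimately show "hahn_norm d (\<lambda>n. x n - y n) = hahn_norm d (\<lambda>n. y n - x n)"
    by (simp add: hahn_norm_def)
  assume x: "x \<in> hahn d" and y: "y \<in> hahn d"
  show "hahn_norm d (\<lambda>n. x n - y n) = 0 \<longleftrightarrow> x = y"
  proof
    assume "hahn_norm d (\<lambda>n. x n - y n) = 0"
    then have "x n - y n = 0" for n
      by (rule hahn_norm_eq_0[OF d diff[OF x y]])
    then show "x = y" by auto
  next
    assume "x = y"
    then show "hahn_norm d (\<lambda>n. x n - y n) = 0"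
      by (simp add: hahn_norm_def)
  qed
  assume z: "z \<in> hahn d"
  show "hahn_norm d (\<lambda>n. x n - z n)
      \<le> hahn_norm d (\<lambda>n. x n - y n) + hahn_norm d (\<lambda>n. y n - z n)"
    using hahn_add(2)[OF d diff[OF x y] diff[OF y z]] by simp
qed

end

theory Submission
  imports Defs
begin

text \<open>
  Reading sequences as formal power series, \<open>T\<^sub>a - \<lambda>\<close> is multiplication by \<open>B = \<Phi>\<^sub>a - \<lambda>\<close>.
  Every power series whose radius of convergence exceeds \<open>r\<close> acts boundedly on \<open>h\<^sub>d\<close>, because
  \<open>d\<^bsub>n+k\<^esub> \<le> C \<rho>\<^sup>k d\<^sub>n\<close> for each \<open>\<rho> > r\<close>. The finitely many zeros of \<open>B\<close> in the closed disc of
  radius \<open>r\<close> can be split off as linear factors \<open>X - z\<close>, and the remaining factor is invertible.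
  If the partial sums of \<open>\<Sum> z\<^sup>k\<close> are \<open>O(d\<^sub>k)\<close>, then \<open>x \<mapsto> \<Sum> x\<^sub>k z\<^sup>k\<close> is a continuous functional that
  annihilates the range of \<open>X - z\<close>; otherwise \<open>1\<close>, and hence all of \<open>h\<^sub>d\<close>, lies in the closure of
  that range. So the range of \<open>T\<^sub>a - \<lambda>\<close> is dense unless \<open>B\<close> vanishes at a point of the first kind,
  and the Hahn-Banach theorem is not needed.
\<close>

section \<open>Convergent power series and the splitting-off of zeros\<close>

lemma fps_conv_radius_linear [simp]:
  "fps_conv_radius (fps_X - fps_const z :: 'a :: {banach, real_normed_div_algebra} fps) = \<infinity>"
  using fps_conv_radius_diff[of fps_X "fps_const z"] by simp

lemma fps_conv_radius_linear_power [simp]: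
  "fps_conv_radius ((fps_X - fps_const z :: 'a :: {banach, real_normed_div_algebra, comm_ring_1} fps) ^ n) = \<infinity>"
  using fps_conv_radius_power[of "fps_X - fps_const z" n] by simp

lemma fps_nth_Abs_fps_fun: "fps_nth (Abs_fps x) = x"
  by (rule ext) simp

text \<open>Being constant and zero at \<open>z\<close> would force the value 0 near the origin,
  where the germ determines all coefficients.\<close>

lemma eval_fps_nonconstant:
  fixes B :: "complex fps"
  assumes "B \<noteq> 0" "ereal (norm z) < fps_conv_radius B" "eval_fps B z = 0"
  shows "\<not> eval_fps B constant_on eball 0 (fps_conv_radius B)"
proof
  let ?S = "eball (0::complex) (fps_conv_radius B)"
  have R: "fps_conv_radius B > 0"
    using assms(2) by (meson ereal_less_eq(5) norm_ge_zero order_le_less_trans)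
  assume "eval_fps B constant_on ?S"
  moreover have "z \<in> ?S"
    using assms by simp
  ultimately have const: "eval_fps B w = 0" if "w \<in> ?S" for w
    using assms(3) that unfolding constant_on_def by metis
  have "eventually (\<lambda>w. w \<in> ?S) (nhds 0)"
    by (intro eventually_nhds_in_open) (use R in \<open>auto simp: zero_ereal_def\<close>)
  then have "eventually (\<lambda>w. eval_fps B w = eval_fps 0 w) (nhds 0)"
    by eventually_elim (simp add: const)
  then have "B = 0"
    by (intro eval_fps_eqD) (use R in auto)
  with \<open>B \<noteq> 0\<close> show False ..
qed

text \<open>The local factorisation at \<open>z\<close> gives a zero-free \<open>g\<close> on a
  small ball. Glued to the quotient \<open>B / (X - z) ^ n\<close> away from \<open>z\<close>, it is
  holomorphic on the whole disc of convergence, so its Taylor series at 0 loses no radius.\<close>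

lemma fps_factor_out_zero:
  fixes B :: "complex fps"
  assumes "B \<noteq> 0" and z: "ereal (norm z) < fps_conv_radius B" and zero: "eval_fps B z = 0"
  obtains n G where "n > 0" "B = (fps_X - fps_const z) ^ n * G"
    "fps_conv_radius G \<ge> fps_conv_radius B" "eval_fps G z \<noteq> 0"
proof -
  let ?R = "fps_conv_radius B"
  let ?S = "eball (0::complex) ?R"
  have R: "?R > 0"
    using z by (meson ereal_less_eq(5) norm_ge_zero order_le_less_trans)
  have "z \<in> ?S" "0 \<in> ?S"
    using z R by (auto simp: zero_ereal_def)
  have hol: "eval_fps B holomorphic_on ?S"
    by (intro holomorphic_intros) auto
  have nonconst: "\<not> eval_fps B constant_on ?S"
    using assms by (rule eval_fps_nonconstant)
  obtain g e n where n: "0 < n" and e: "0 < e" "ball z e \<subseteq> ?S"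
    and g: "g holomorphic_on ball z e"
    and fg: "\<And>w. w \<in> ball z e \<Longrightarrow> eval_fps B w = (w - z) ^ n * g w"
    and gnz: "\<And>w. w \<in> ball z e \<Longrightarrow> g w \<noteq> 0"
    using holomorphic_factor_zero_nonconstant[OF hol open_eball connected_eball \<open>z \<in> ?S\<close> zero nonconst]
    by metis
  define h where "h w = (if w = z then g z else eval_fps B w / (w - z) ^ n)" for w
  have "h holomorphic_on (?S - {z})"
    by (rule holomorphic_transform[of "\<lambda>w. eval_fps B w / (w - z) ^ n"])
      (auto simp: h_def intro!: holomorphic_intros)
  moreover have "h holomorphic_on ball z e"
    by (rule holomorphic_transform[OF g]) (auto simp: h_def fg)
  ultimately have "h holomorphic_on (?S - {z} \<union> ball z e)"
    by (intro holomorphic_on_Un) auto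
  moreover have "?S - {z} \<union> ball z e = ?S"
    using e \<open>z \<in> ?S\<close> by auto
  ultimately have h: "h holomorphic_on ?S"
    by simp
  define G where "G = fps_expansion h 0"
  have radius: "fps_conv_radius G \<ge> ?R"
    unfolding G_def using h by (rule conv_radius_fps_expansion)
  have eval: "eval_fps G w = h w" if "w \<in> ?S" for w
    unfolding G_def using eval_fps_expansion[OF h that] by simp
  have "eval_fps ((fps_X - fps_const z) ^ n * G) w = eval_fps B w" if "w \<in> ?S" for w
  proof -
    have w: "ereal (norm w) < fps_conv_radius G"
      using that radius by (auto intro: less_le_trans)
    have "eval_fps ((fps_X - fps_const z) ^ n * G) w = (w - z) ^ n * h w"
      using w eval[OF that] by (simp add: eval_fps_mult eval_fps_power eval_fps_diff)
    also have "\<dots> = eval_fps B w"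
      using n zero by (auto simp: h_def)
    finally show ?thesis .
  qed
  moreover have "eventually (\<lambda>w. w \<in> ?S) (nhds 0)"
    by (intro eventually_nhds_in_open \<open>0 \<in> ?S\<close>) auto
  ultimately have ev: "eventually (\<lambda>w. eval_fps B w = eval_fps ((fps_X - fps_const z) ^ n * G) w) (nhds 0)"
    by (auto elim: eventually_mono)
  have "fps_conv_radius ((fps_X - fps_const z) ^ n * G) > 0"
    using fps_conv_radius_mult[of "(fps_X - fps_const z) ^ n" G] radius R
    by (auto dest: less_le_trans)
  then have "B = (fps_X - fps_const z) ^ n * G"
    using R ev by (intro eval_fps_eqD)
  moreover have "eval_fps G z \<noteq> 0"
    using eval[OF \<open>z \<in> ?S\<close>] gnz e by (simp add: h_def)
  ultimately show thesis
    using that n radius by blast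
qed

section \<open>Convolution as multiplication, continuous functionals, radius of convergence\<close>

lemma conv_op_eq_fps_mult: "conv_op a x = fps_nth (Abs_fps a * Abs_fps x)"
proof
  fix n
  have "fps_nth (Abs_fps x * Abs_fps a) n = (\<Sum>k\<le>n. x k * a (n - k))"
    by (simp add: fps_mult_nth atLeast0AtMost)
  then show "conv_op a x n = fps_nth (Abs_fps a * Abs_fps x) n"
    unfolding conv_op_def mult.commute[of "Abs_fps a"] by (simp add: mult.commute)
qed

lemma cont_dualI:
  assumes "\<And>x. x \<notin> X \<Longrightarrow> f x = 0"
    and "\<And>x y. x \<in> X \<Longrightarrow> y \<in> X \<Longrightarrow> f (\<lambda>i. x i + y i) = f x + f y"
    and "\<And>c x. x \<in> X \<Longrightarrow> f (\<lambda>i. c * x i) = c * f x"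
    and "\<And>x. x \<in> X \<Longrightarrow> cmod (f x) \<le> C * N x"
  shows "f \<in> cont_dual X N"
  using assms unfolding cont_dual_def by blast

lemma
  assumes "f \<in> cont_dual X N"
  shows cont_dual_outside: "x \<notin> X \<Longrightarrow> f x = 0"
    and cont_dual_add: "x \<in> X \<Longrightarrow> y \<in> X \<Longrightarrow> f (\<lambda>i. x i + y i) = f x + f y"
    and cont_dual_scale: "x \<in> X \<Longrightarrow> f (\<lambda>i. c * x i) = c * f x"
    and cont_dual_bound: "\<exists>C. \<forall>x\<in>X. cmod (f x) \<le> C * N x"
  using assms unfolding cont_dual_def by blast+

text \<open>By compactness \<open>U\<close> contains an \<open>e\<close>-neighbourhood of the closed
  disc, hence the real point \<open>r + e / 2\<close>; convergence there yields the strict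
  inequality on which all later estimates rest.\<close>

lemma fps_conv_radius_gt_of_summable_nhd:
  fixes a :: "nat \<Rightarrow> complex"
  assumes "open U" "cball 0 r \<subseteq> U" "\<forall>z\<in>U. summable (\<lambda>n. a n * z ^ n)" "0 \<le> r"
  shows "ereal r < fps_conv_radius (Abs_fps a)"
proof -
  obtain e where e: "e > 0" "(\<Union>x\<in>cball 0 r. ball x e) \<subseteq> U"
    using compact_subset_open_imp_ball_epsilon_subset[of "cball (0::complex) r" U] assms by auto
  have "complex_of_real (r + e / 2) \<in> ball (complex_of_real r) e"
    using e(1) by (simp add: dist_norm)
  then have "complex_of_real (r + e / 2) \<in> U"
    using e(2) \<open>0 \<le> r\<close> by (auto intro!: UN_I[of "complex_of_real r"])
  then have "summable (\<lambda>n. a n * complex_of_real (r + e / 2) ^ n)"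
    using assms(3) by blast
  then have "ereal (cmod (complex_of_real (r + e / 2))) \<le> fps_conv_radius (Abs_fps a)"
    unfolding fps_conv_radius_def fps_nth_Abs_fps_fun by (rule conv_radius_geI)
  moreover have "cmod (complex_of_real (r + e / 2)) = r + e / 2"
    using e(1) \<open>0 \<le> r\<close> by (simp only: norm_of_real)
  ultimately have "ereal (r + e / 2) \<le> fps_conv_radius (Abs_fps a)"
    by simp
  moreover have "ereal r < ereal (r + e / 2)"
    using e(1) by simp
  ultimately show ?thesis
    by (rule less_le_trans[rotated])
qed

section \<open>The Hahn space as a space of formal power series\<close>

locale hahn_weight =
  fixes d :: "nat \<Rightarrow> real" and r :: real
  assumes mono_d: "mono d"
    and unbounded_d: "\<not> bdd_above (range d)"
    and pos_d: "0 < d n"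
    and ratio_d: "(\<lambda>n. d (Suc n) / d n) \<longlonglongrightarrow> r"
    and r_ge_1: "1 \<le> r"
begin

text \<open>Moving to formal power series turns convolution into the product of an integral domain,
  so operators can be factored and cancelled algebraically.\<close>

abbreviation H :: "complex fps set"
  where "H \<equiv> {F. fps_nth F \<in> hahn d}"

definition N :: "complex fps \<Rightarrow> real"
  where "N F = hahn_norm d (fps_nth F)"

lemma H_add: "F \<in> H \<Longrightarrow> G \<in> H \<Longrightarrow> F + G \<in> H"
  using hahn_add(1)[OF pos_d, where x = "fps_nth F" and y = "fps_nth G"] by (simp add: fps_add_nth[abs_def])

lemma N_add: "F \<in> H \<Longrightarrow> G \<in> H \<Longrightarrow> N (F + G) \<le> N F + N G"
  using hahn_add(2)[OF pos_d, where x = "fps_nth F" and y = "fps_nth G"] by (simp add: N_def fps_add_nth[abs_def])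

lemma H_cmult: "F \<in> H \<Longrightarrow> fps_const c * F \<in> H"
  using hahn_scale(1)[of "fps_nth F" d c] by (simp add: fps_mult_left_const_nth[abs_def])

lemma N_cmult: "F \<in> H \<Longrightarrow> N (fps_const c * F) = cmod c * N F"
  using hahn_scale(2)[of "fps_nth F" d c] by (simp add: N_def fps_mult_left_const_nth[abs_def])

lemma H_uminus: "F \<in> H \<Longrightarrow> - F \<in> H"
  using H_cmult[of F "-1"] by (simp flip: fps_const_neg)

lemma H_diff: "F \<in> H \<Longrightarrow> G \<in> H \<Longrightarrow> F - G \<in> H"
  using H_add[of F "- G"] H_uminus[of G] by simp

lemma N_nonneg: "0 \<le> N F"
  unfolding N_def by (rule hahn_norm_nonneg[OF pos_d])

lemma H_finite_support:
  assumes "\<And>n. n > m \<Longrightarrow> fps_nth F n = 0"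
  shows "F \<in> H" "N F = (\<Sum>n\<le>m. d n * cmod (fps_nth F n - fps_nth F (Suc n)))"
proof -
  let ?f = "\<lambda>n. d n * cmod (fps_nth F n - fps_nth F (Suc n))"
  have sums: "?f sums (\<Sum>n\<le>m. ?f n)"
    by (rule sums_finite) (auto simp: assms)
  have "fps_nth F \<longlonglongrightarrow> 0"
    by (rule tendsto_eventually, rule eventually_sequentiallyI[of "Suc m"]) (simp add: assms)
  then show "F \<in> H"
    using sums by (auto simp: hahn_def sums_iff)
  then show "N F = (\<Sum>n\<le>m. ?f n)"
    using sums by (simp add: N_def hahn_norm_def sums_iff)
qed

lemma zero_H: "0 \<in> H" and N_0: "N 0 = 0"
  using H_finite_support[of 0 0] by auto

lemma H_X_power: "fps_X ^ k \<in> H"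
  by (rule H_finite_support[of k]) simp

lemma one_H: "1 \<in> H"
  using H_X_power[of 0] by simp

lemma H_summable: "F \<in> H \<Longrightarrow> summable (\<lambda>n. d n * cmod (fps_nth F n - fps_nth F (Suc n)))"
  and H_tendsto: "F \<in> H \<Longrightarrow> fps_nth F \<longlonglongrightarrow> 0"
  and N_eq: "F \<in> H \<Longrightarrow> N F = (\<Sum>n. d n * cmod (fps_nth F n - fps_nth F (Suc n)))"
  by (auto simp: N_def hahn_def hahn_norm_def)

text \<open>Since the coefficients tend to 0, the \<open>n\<close>-th one telescopes into the sum of
  all later differences; monotonicity then allows \<open>d n\<close> to be replaced by
  \<open>d (k + n)\<close> under the sum.\<close>

lemma weighted_coeff_le_tail:
  assumes F: "F \<in> H"
  shows "d n * cmod (fps_nth F n)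
    \<le> (\<Sum>k. d (k + n) * cmod (fps_nth F (k + n) - fps_nth F (Suc (k + n))))"
proof -
  let ?D = "\<lambda>k. fps_nth F (k + n) - fps_nth F (Suc (k + n))"
  have s: "summable (\<lambda>k. d (k + n) * cmod (?D k))"
    using summable_ignore_initial_segment[OF H_summable[OF F], of n] by simp
  have le: "d n * cmod (?D k) \<le> d (k + n) * cmod (?D k)" for k
    using mono_d by (intro mult_right_mono) (auto intro: monoD)
  have s': "summable (\<lambda>k. d n * cmod (?D k))"
    using le pos_d[of n] by (intro summable_comparison_test'[OF s]) (auto simp: abs_mult)
  then have s'': "summable (\<lambda>k. cmod (?D k))"
    using pos_d[of n] by (simp add: summable_cmult_iff)
  have "(\<lambda>k. fps_nth F (k + n)) \<longlonglongrightarrow> 0"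
    using H_tendsto[OF F] by (rule LIMSEQ_ignore_initial_segment)
  then have "?D sums fps_nth F n"
    using telescope_sums' by fastforce
  then have "cmod (fps_nth F n) \<le> (\<Sum>k. cmod (?D k))"
    using summable_norm[OF s''] by (simp add: sums_iff)
  then have "d n * cmod (fps_nth F n) \<le> (\<Sum>k. d n * cmod (?D k))"
    using pos_d[of n] s'' by (simp add: suminf_mult)
  also have "\<dots> \<le> (\<Sum>k. d (k + n) * cmod (?D k))"
    by (rule suminf_le[OF le s' s])
  finally show ?thesis .
qed

lemma weighted_coeff_le:
  assumes F: "F \<in> H"
  shows "d n * cmod (fps_nth F n) \<le> N F"
proof -
  let ?f = "\<lambda>k. d k * cmod (fps_nth F k - fps_nth F (Suc k))"
  have "N F = (\<Sum>k. ?f (k + n)) + (\<Sum>k<n. ?f k)"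
    using suminf_split_initial_segment[OF H_summable[OF F]] N_eq[OF F] by simp
  moreover have "(\<Sum>k<n. ?f k) \<ge> 0"
    using pos_d by (intro sum_nonneg) (simp add: less_imp_le)
  ultimately show ?thesis
    using weighted_coeff_le_tail[OF F, of n] by simp
qed

lemma d_at_top: "filterlim d at_top sequentially"
  unfolding filterlim_at_top
proof
  fix Z
  obtain n where "d n \<ge> Z"
    using unbounded_d by (meson bdd_aboveI2 linear)
  then show "eventually (\<lambda>n. Z \<le> d n) sequentially"
    using mono_d by (auto intro!: eventually_sequentiallyI[of n] dest: monoD intro: order_trans)
qed

section \<open>Growth of the weight and boundedness of multiplication\<close>

text \<open>The quotient \<open>D n = d n / \<rho> ^ n\<close> decreases from some \<open>M\<close>
  on, because the ratios of \<open>d\<close> eventually stay below \<open>\<rho>\<close>. The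
  indices up to \<open>M\<close> cost the factor \<open>mx / mn\<close>, the quotient of the extreme
  values of \<open>D\<close> there.\<close>

lemma growth:
  assumes "r < \<rho>"
  obtains C where "C > 0" "\<And>n k. d (n + k) \<le> C * \<rho> ^ k * d n"
proof -
  have \<rho>: "\<rho> > 0"
    using assms r_ge_1 by simp
  define D where "D n = d n / \<rho> ^ n" for n
  have Dpos: "D n > 0" for n
    using pos_d \<rho> by (simp add: D_def)
  obtain M where M: "\<And>n. n \<ge> M \<Longrightarrow> d (Suc n) / d n < \<rho>"
    using order_tendstoD(2)[OF ratio_d assms] by (auto simp: eventually_sequentially)
  have dec: "D (n + k) \<le> D n" if "n \<ge> M" for n k
  proof (induction k)
    case (Suc k)
    have "d (Suc (n + k)) \<le> \<rho> * d (n + k)"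
      using M[of "n + k"] that pos_d[of "n + k"] by (simp add: field_simps)
    then have "D (Suc (n + k)) \<le> D (n + k)"
      using \<rho> by (simp add: D_def field_simps)
    then show ?case using Suc by simp
  qed simp
  define mx where "mx = Max (D ` {..M})"
  define mn where "mn = Min (D ` {..M})"
  have mx: "D j \<le> mx" and mn: "mn \<le> D j" if "j \<le> M" for j
    using that by (auto simp: mx_def mn_def)
  have mnpos: "mn > 0"
    unfolding mn_def by (subst Min_gr_iff) (auto simp: Dpos)
  define C where "C = mx / mn"
  have C: "C \<ge> 1"
    using mx[of 0] mn[of 0] mnpos by (simp add: C_def)
  have bound: "D (n + k) \<le> C * D n" for n k
  proof (cases "n \<ge> M")
    case True
    have "D n \<le> C * D n"
      using C Dpos[of n] by simp
    with dec[OF True, of k] show ?thesis by simp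
  next
    case False
    have "D (n + k) \<le> mx"
    proof (cases "n + k \<le> M")
      case True
      then show ?thesis by (rule mx)
    next
      case F: False
      then show ?thesis
        using dec[of M "n + k - M"] mx[of M] by simp
    qed
    also have "mx = C * mn"
      using mnpos by (simp add: C_def)
    also have "\<dots> \<le> C * D n"
      using mn[of n] False C by (intro mult_left_mono) auto
    finally show ?thesis .
  qed
  have "d (n + k) \<le> C * \<rho> ^ k * d n" for n k
    using bound[of n k] \<rho> by (simp add: D_def power_add field_simps)
  with C show thesis
    by (intro that[of C]) auto
qed

text \<open>With \<open>\<rho>\<close> strictly between \<open>r\<close> and the radius,
  \<open>b i = |B i| \<rho> ^ i\<close> is summable, and \<open>growth\<close> transfers the weight
  from index \<open>n\<close> to index \<open>n - i\<close> at the price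
  \<open>K * \<rho> ^ i\<close>. The norm of the product is then controlled by the Cauchy product of
  \<open>b\<close> with the terms \<open>f\<close> of the norm of \<open>F\<close>, plus a boundary
  term.\<close>

lemma fps_mult_bounded:
  assumes B: "ereal r < fps_conv_radius B"
  obtains C where "C > 0" "\<And>F. F \<in> H \<Longrightarrow> B * F \<in> H" "\<And>F. F \<in> H \<Longrightarrow> N (B * F) \<le> C * N F"
proof -
  obtain \<rho> where \<rho>: "r < \<rho>" "ereal \<rho> < fps_conv_radius B"
    using ereal_dense2[OF B] by auto
  have \<rho>1: "1 < \<rho>" using \<rho> r_ge_1 by simp
  obtain K where K: "K > 0" and grow: "\<And>n k. d (n + k) \<le> K * \<rho> ^ k * d n"
    using growth[OF \<rho>(1)] by metis
  define b where "b n = cmod (fps_nth B n) * \<rho> ^ n" for n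
  have sb: "summable b"
    using norm_summable_fps[of "complex_of_real \<rho>" B] \<rho> \<rho>1
    by (simp add: b_def[abs_def] norm_mult norm_power)
  have b0: "b n \<ge> 0" for n
    using \<rho>1 by (simp add: b_def)
  define S where "S = suminf b"
  have S0: "S \<ge> 0"
    unfolding S_def by (rule suminf_nonneg[OF sb b0])
  \<comment> \<open>The summand 1 keeps the constant positive even if \<open>S = 0\<close>.\<close>
  have "B * F \<in> H \<and> N (B * F) \<le> (2 * K * S + 1) * N F" if F: "F \<in> H" for F
  proof -
    define f where "f n = d n * cmod (fps_nth F n - fps_nth F (Suc n))" for n
    have f0: "f n \<ge> 0" for n
      using pos_d by (simp add: f_def less_imp_le)
    have sf: "summable f" and Nf: "N F = suminf f"
      using H_summable[OF F] N_eq[OF F] by (simp_all add: f_def[abs_def])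
    have sum_bf: "(\<lambda>n. \<Sum>i\<le>n. b i * f (n - i)) sums (S * N F)"
      unfolding S_def Nf using sb sf b0 f0 by (intro Cauchy_product_sums) auto
    have sum_b: "(\<lambda>n. b (Suc n)) sums (S - b 0)"
      using sb by (subst sums_Suc_iff) (simp add: S_def summable_sums)
    let ?g = "\<lambda>n. d n * cmod (fps_nth (B * F) n - fps_nth (B * F) (Suc n))"
    let ?h = "\<lambda>n. K * (\<Sum>i\<le>n. b i * f (n - i)) + K * N F * b (Suc n)"
    have sum_h: "?h sums (K * (S * N F) + K * N F * (S - b 0))"
      by (intro sums_add sums_mult sum_bf sum_b)
    have gh: "?g n \<le> ?h n" for n
    proof -
      \<comment> \<open>The difference is moved onto \<open>F\<close>. The coefficient at
        \<open>Suc n\<close> has one summand more, which survives as the boundary term with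
        \<open>F 0\<close>.\<close>
      have "fps_nth (B * F) n - fps_nth (B * F) (Suc n)
          = (\<Sum>i\<le>n. fps_nth B i * (fps_nth F (n - i) - fps_nth F (Suc (n - i))))
            - fps_nth B (Suc n) * fps_nth F 0"
        by (simp add: fps_mult_nth atLeast0AtMost Suc_diff_le right_diff_distrib sum_subtractf)
      then have "cmod (fps_nth (B * F) n - fps_nth (B * F) (Suc n))
          \<le> cmod (\<Sum>i\<le>n. fps_nth B i * (fps_nth F (n - i) - fps_nth F (Suc (n - i))))
            + cmod (fps_nth B (Suc n) * fps_nth F 0)"
        by (metis norm_triangle_ineq4)
      also have "\<dots> \<le> (\<Sum>i\<le>n. cmod (fps_nth B i) * cmod (fps_nth F (n - i) - fps_nth F (Suc (n - i))))
          + cmod (fps_nth B (Suc n)) * cmod (fps_nth F 0)"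
        by (intro add_mono order_trans[OF norm_sum]) (simp_all add: norm_mult)
      finally have "?g n \<le> d n * ((\<Sum>i\<le>n. cmod (fps_nth B i) * cmod (fps_nth F (n - i) - fps_nth F (Suc (n - i))))
          + cmod (fps_nth B (Suc n)) * cmod (fps_nth F 0))"
        using pos_d[of n] by (intro mult_left_mono) auto
      also have "\<dots> = (\<Sum>i\<le>n. d n * (cmod (fps_nth B i) * cmod (fps_nth F (n - i) - fps_nth F (Suc (n - i)))))
          + d n * (cmod (fps_nth B (Suc n)) * cmod (fps_nth F 0))"
        by (simp add: distrib_left sum_distrib_left)
      also have "\<dots> \<le> (\<Sum>i\<le>n. K * (b i * f (n - i))) + K * N F * b (Suc n)"
      proof (intro add_mono sum_mono)
        fix i assume "i \<in> {..n}"
        then have "d n \<le> K * \<rho> ^ i * d (n - i)"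
          using grow[of "n - i" i] by simp
        then have "d n * (cmod (fps_nth B i) * cmod (fps_nth F (n - i) - fps_nth F (Suc (n - i))))
           \<le> (K * \<rho> ^ i * d (n - i)) * (cmod (fps_nth B i) * cmod (fps_nth F (n - i) - fps_nth F (Suc (n - i))))"
          by (rule mult_right_mono) simp
        then show "d n * (cmod (fps_nth B i) * cmod (fps_nth F (n - i) - fps_nth F (Suc (n - i))))
           \<le> K * (b i * f (n - i))"
          by (simp add: b_def f_def mult_ac)
      next
        \<comment> \<open>The weight has index \<open>n\<close> but the coefficient of
          \<open>B\<close> has index \<open>Suc n\<close>; one further factor
          \<open>\<rho> > 1\<close> matches the two, giving \<open>b (Suc n)\<close>.\<close>
        have "d n \<le> K * \<rho> ^ n * d 0"
          using grow[of 0 n] by simp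
        also have "\<dots> \<le> K * \<rho> ^ Suc n * d 0"
          using K \<rho>1 pos_d[of 0] by (intro mult_right_mono mult_left_mono power_increasing) auto
        finally have "d n * (cmod (fps_nth B (Suc n)) * cmod (fps_nth F 0))
            \<le> (K * \<rho> ^ Suc n * d 0) * (cmod (fps_nth B (Suc n)) * cmod (fps_nth F 0))"
          by (rule mult_right_mono) simp
        also have "\<dots> = (K * b (Suc n)) * (d 0 * cmod (fps_nth F 0))"
          by (simp add: b_def mult_ac)
        also have "\<dots> \<le> (K * b (Suc n)) * N F"
          using weighted_coeff_le[OF F, of 0] K b0 by (intro mult_left_mono) auto
        finally show "d n * (cmod (fps_nth B (Suc n)) * cmod (fps_nth F 0)) \<le> K * N F * b (Suc n)"
          by (simp add: mult_ac)
      qed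
      finally show ?thesis
        by (simp add: sum_distrib_left)
    qed
    have g0: "?g n \<ge> 0" for n
      using pos_d by (simp add: less_imp_le)
    have sg: "summable ?g"
      using gh g0 by (intro summable_comparison_test'[OF sums_summable[OF sum_h]]) auto
    \<comment> \<open>The same transfer of weights, applied to the coefficients instead of their
      differences, bounds \<open>d n\<close> times the \<open>n\<close>-th coefficient uniformly;
      division by \<open>d n\<close>, which tends to infinity, gives the limit.\<close>
    have "fps_nth (B * F) \<longlonglongrightarrow> 0"
    proof (rule Lim_null_comparison)
      show "eventually (\<lambda>n. cmod (fps_nth (B * F) n) \<le> K * N F * S / d n) sequentially"
      proof (rule always_eventually, rule allI)
        fix n
        have "d n * cmod (fps_nth (B * F) n) \<le> d n * (\<Sum>i\<le>n. cmod (fps_nth B i) * cmod (fps_nth F (n - i)))"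
          using pos_d[of n] unfolding fps_mult_nth atLeast0AtMost norm_mult[symmetric]
          by (intro mult_left_mono norm_sum) auto
        also have "\<dots> = (\<Sum>i\<le>n. d n * (cmod (fps_nth B i) * cmod (fps_nth F (n - i))))"
          by (simp add: sum_distrib_left)
        also have "\<dots> \<le> (\<Sum>i\<le>n. K * N F * b i)"
        proof (rule sum_mono)
          fix i assume "i \<in> {..n}"
          then have "d n \<le> K * \<rho> ^ i * d (n - i)"
            using grow[of "n - i" i] by simp
          then have "d n * (cmod (fps_nth B i) * cmod (fps_nth F (n - i)))
             \<le> (K * \<rho> ^ i * d (n - i)) * (cmod (fps_nth B i) * cmod (fps_nth F (n - i)))"
            by (rule mult_right_mono) simp
          also have "\<dots> = (K * b i) * (d (n - i) * cmod (fps_nth F (n - i)))"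
            by (simp add: b_def mult_ac)
          also have "\<dots> \<le> (K * b i) * N F"
            using weighted_coeff_le[OF F] K b0 by (intro mult_left_mono) auto
          finally show "d n * (cmod (fps_nth B i) * cmod (fps_nth F (n - i))) \<le> K * N F * b i"
            by (simp add: mult_ac)
        qed
        also have "\<dots> = K * N F * (\<Sum>i\<le>n. b i)"
          by (simp add: sum_distrib_left)
        also have "\<dots> \<le> K * N F * S"
          unfolding S_def using K N_nonneg[of F] b0
          by (intro mult_left_mono sum_le_suminf sb) auto
        finally show "cmod (fps_nth (B * F) n) \<le> K * N F * S / d n"
          using pos_d[of n] by (simp add: field_simps)
      qed
      show "(\<lambda>n. K * N F * S / d n) \<longlonglongrightarrow> 0"
        by (intro real_tendsto_divide_at_top[OF tendsto_const d_at_top])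
    qed
    with sg have mem: "B * F \<in> H"
      by (simp add: hahn_def)
    have "N (B * F) \<le> K * (S * N F) + K * N F * (S - b 0)"
      using suminf_le[OF gh sg sums_summable[OF sum_h]] sum_h N_eq[OF mem] by (simp add: sums_iff)
    also have "\<dots> \<le> 2 * K * S * N F"
      using K N_nonneg[of F] b0[of 0] by (simp add: algebra_simps)
    also have "\<dots> \<le> (2 * K * S + 1) * N F"
      using N_nonneg[of F] by (simp add: algebra_simps)
    finally show ?thesis
      using mem by blast
  qed
  moreover have "2 * K * S + 1 > 0"
    using K S0 by (simp add: add_nonneg_pos)
  ultimately show thesis
    using that by blast
qed

section \<open>Multiplication operators with dense range\<close>

text \<open>As \<open>N\<close> takes the value 0 outside \<open>H\<close>, this expresses density
  only when multiplication by \<open>B\<close> maps \<open>H\<close> into itself, which a radius of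
  convergence beyond \<open>r\<close> guarantees.\<close>

definition dense_range :: "complex fps \<Rightarrow> bool"
  where "dense_range B \<longleftrightarrow> (\<forall>F\<in>H. \<forall>e>0. \<exists>U\<in>H. N (F - B * U) < e)"

text \<open>First \<open>F\<close> is approximated by \<open>A * U\<close>, then \<open>U\<close> by
  \<open>B * V\<close>. Multiplication by \<open>A\<close> magnifies the second error by at most
  \<open>C\<close>, hence the tolerance \<open>e / (2 * C)\<close>.\<close>

lemma dense_range_mult:
  assumes A: "ereal r < fps_conv_radius A" "dense_range A"
    and B: "ereal r < fps_conv_radius B" "dense_range B"
  shows "dense_range (A * B)"
  unfolding dense_range_def
proof (intro ballI allI impI)
  fix F and e :: real
  assume F: "F \<in> H" and e: "e > 0"
  obtain C where C: "C > 0" and AH: "\<And>F. F \<in> H \<Longrightarrow> A * F \<in> H"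
    and AN: "\<And>F. F \<in> H \<Longrightarrow> N (A * F) \<le> C * N F"
    using fps_mult_bounded[OF A(1)] by blast
  obtain BH: "\<And>F. F \<in> H \<Longrightarrow> B * F \<in> H"
    using fps_mult_bounded[OF B(1)] by blast
  obtain U where U: "U \<in> H" "N (F - A * U) < e / 2"
    using A(2) F e unfolding dense_range_def by (meson half_gt_zero)
  obtain V where V: "V \<in> H" "N (U - B * V) < e / (2 * C)"
    using B(2) U(1) e C unfolding dense_range_def
    by (meson divide_pos_pos mult_pos_pos zero_less_numeral)
  have "N (A * (U - B * V)) \<le> C * N (U - B * V)"
    by (intro AN H_diff BH U V)
  also have "\<dots> < e / 2"
    using V(2) C by (simp add: field_simps)
  finally have small: "N (A * (U - B * V)) < e / 2" .
  have "F - A * B * V = (F - A * U) + A * (U - B * V)"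
    by (simp add: algebra_simps)
  also have "N \<dots> \<le> N (F - A * U) + N (A * (U - B * V))"
    by (intro N_add H_diff AH BH F U V)
  finally show "\<exists>W\<in>H. N (F - A * B * W) < e"
    using V(1) U(2) small by (intro bexI[of _ V]) auto
qed

lemma dense_range_unit:
  assumes "A * A' = 1" "ereal r < fps_conv_radius A'"
  shows "dense_range A"
  unfolding dense_range_def
proof (intro ballI allI impI)
  fix F and e :: real
  assume F: "F \<in> H" and e: "e > 0"
  have "A' * F \<in> H"
    using fps_mult_bounded[OF assms(2)] F by blast
  moreover have "F - A * (A' * F) = 0"
    using assms(1) by (simp flip: mult.assoc)
  ultimately show "\<exists>U\<in>H. N (F - A * U) < e"
    using N_0 e by (metis)
qed

lemma dense_range_power:
  assumes "ereal r < fps_conv_radius A" "dense_range A"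
  shows "dense_range (A ^ n)"
proof (induction n)
  case 0
  show ?case
    using dense_range_unit[of 1 1] by simp
next
  case (Suc n)
  have "ereal r < fps_conv_radius (A ^ n)"
    using assms(1) fps_conv_radius_power[of A n] by (rule less_le_trans)
  then show ?case
    using dense_range_mult[OF assms _ Suc] by simp
qed

text \<open>The error \<open>G\<close> has two contributions: the tail of the series for
  \<open>N F\<close>, and the jump at \<open>M\<close> created by cutting off. The jump is again at
  most the tail by \<open>weighted_coeff_le_tail\<close>, so a tail below \<open>e / 2\<close>
  suffices.\<close>

lemma truncation_approx:
  assumes F: "F \<in> H" and e: "e > 0"
  obtains m where "N (F - Abs_fps (\<lambda>n. if n \<le> m then fps_nth F n else 0)) < e"
proof -
  let ?f = "\<lambda>n. d n * cmod (fps_nth F n - fps_nth F (Suc n))"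
  note sf = H_summable[OF F]
  obtain M where M: "\<And>n. n \<ge> M \<Longrightarrow> norm (\<Sum>i. ?f (i + n)) < e / 2"
    using suminf_exist_split[OF _ sf, of "e / 2"] e by auto
  define G where "G = F - Abs_fps (\<lambda>n. if n \<le> M then fps_nth F n else 0)"
  have G: "fps_nth G n = (if n \<le> M then 0 else fps_nth F n)" for n
    by (simp add: G_def)
  have "Abs_fps (\<lambda>n. if n \<le> M then fps_nth F n else 0) \<in> H"
    by (rule H_finite_support[of M]) simp
  then have GH: "G \<in> H"
    unfolding G_def by (intro H_diff F)
  let ?g = "\<lambda>n. d n * cmod (fps_nth G n - fps_nth G (Suc n))"
  have "N G = (\<Sum>n. ?g (n + Suc M)) + (\<Sum>n<Suc M. ?g n)"
    using suminf_split_initial_segment[OF H_summable[OF GH], of "Suc M"] N_eq[OF GH] by simp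
  also have "(\<Sum>n<Suc M. ?g n) = d M * cmod (fps_nth F (Suc M))"
    by (simp add: G)
  also have "\<dots> \<le> d (Suc M) * cmod (fps_nth F (Suc M))"
    using mono_d by (intro mult_right_mono) (auto simp: mono_iff_le_Suc)
  also have "\<dots> \<le> (\<Sum>n. ?f (n + Suc M))"
    using weighted_coeff_le_tail[OF F, of "Suc M"] by simp
  also have "(\<Sum>n. ?g (n + Suc M)) = (\<Sum>n. ?f (n + Suc M))"
    by (simp add: G)
  also have "(\<Sum>n. ?f (n + Suc M)) + (\<Sum>n. ?f (n + Suc M)) < e"
    using M[of "Suc M"] by simp
  finally show thesis
    using that[of M] by (simp add: G_def)
qed

text \<open>The predicate \<open>cl\<close> describes the closure of the range, a linear subspace.
  From \<open>X ^ Suc k = (X - z) * X ^ k + z * X ^ k\<close> it contains all powers of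
  \<open>X\<close> once it contains 1, hence all polynomials, and these are dense by
  \<open>truncation_approx\<close>.\<close>

lemma dense_range_linear:
  assumes one: "\<And>e. e > 0 \<Longrightarrow> \<exists>U\<in>H. N (1 - (fps_X - fps_const z) * U) < e"
  shows "dense_range (fps_X - fps_const z)"
proof -
  let ?L = "fps_X - fps_const z"
  obtain C where LH: "\<And>F. F \<in> H \<Longrightarrow> ?L * F \<in> H"
    using fps_mult_bounded[of ?L] by auto
  define cl where "cl F \<longleftrightarrow> F \<in> H \<and> (\<forall>e>0. \<exists>U\<in>H. N (F - ?L * U) < e)" for F
  have cl_add: "cl (F + G)" if "cl F" "cl G" for F G
  proof -
    have "\<exists>W\<in>H. N (F + G - ?L * W) < e" if e: "e > 0" for e
    proof -
      obtain U V where U: "U \<in> H" "N (F - ?L * U) < e / 2" and V: "V \<in> H" "N (G - ?L * V) < e / 2"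
        using \<open>cl F\<close> \<open>cl G\<close> e unfolding cl_def by (meson half_gt_zero)
      have "F + G - ?L * (U + V) = (F - ?L * U) + (G - ?L * V)"
        by (simp add: algebra_simps)
      also have "N \<dots> \<le> N (F - ?L * U) + N (G - ?L * V)"
        using \<open>cl F\<close> \<open>cl G\<close> U V unfolding cl_def by (intro N_add H_diff LH) auto
      finally show ?thesis
        using U V by (intro bexI[of _ "U + V"] H_add) auto
    qed
    then show ?thesis
      using that H_add unfolding cl_def by auto
  qed
  have cl_cmult: "cl (fps_const c * F)" if F: "cl F" for c F
  proof -
    have "\<exists>W\<in>H. N (fps_const c * F - ?L * W) < e" if e: "e > 0" for e
    proof -
      have "e / (cmod c + 1) > 0"
        using e by (simp add: add_nonneg_pos)
      then obtain U where U: "U \<in> H" "N (F - ?L * U) < e / (cmod c + 1)"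
        using F unfolding cl_def by meson
      have "fps_const c * F - ?L * (fps_const c * U) = fps_const c * (F - ?L * U)"
        by (simp add: algebra_simps)
      also have "N \<dots> = cmod c * N (F - ?L * U)"
        using F U unfolding cl_def by (intro N_cmult H_diff LH) auto
      also have "\<dots> \<le> (cmod c + 1) * N (F - ?L * U)"
        using N_nonneg by (intro mult_right_mono) auto
      also have "\<dots> < e"
        using U(2) add_nonneg_pos[of "cmod c" 1] by (simp add: field_simps)
      finally show ?thesis
        using U by (intro bexI[of _ "fps_const c * U"] H_cmult) auto
    qed
    then show ?thesis
      using F H_cmult unfolding cl_def by auto
  qed
  have cl_range: "cl (?L * F)" if "F \<in> H" for F
    unfolding cl_def using that LH N_0 by (auto intro!: bexI[of _ F])
  have cl_X: "cl (fps_X ^ k)" for k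
  proof (induction k)
    case 0
    show ?case
      using one one_H by (simp add: cl_def)
  next
    case (Suc k)
    have "fps_X ^ Suc k = ?L * fps_X ^ k + fps_const z * fps_X ^ k"
      by (simp add: algebra_simps)
    then show ?case
      using cl_add[OF cl_range[OF H_X_power] cl_cmult[OF Suc]] by metis
  qed
  have cl_trunc: "cl (Abs_fps (\<lambda>n. if n \<le> m then fps_nth F n else 0))" for F m
  proof (induction m)
    case 0
    have "Abs_fps (\<lambda>n. if n \<le> 0 then fps_nth F n else 0) = fps_const (fps_nth F 0) * fps_X ^ 0"
      by (rule fps_ext) auto
    then show ?case
      using cl_cmult[OF cl_X] by metis
  next
    case (Suc m)
    have "Abs_fps (\<lambda>n. if n \<le> Suc m then fps_nth F n else 0)
       = Abs_fps (\<lambda>n. if n \<le> m then fps_nth F n else 0) + fps_const (fps_nth F (Suc m)) * fps_X ^ Suc m"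
      by (rule fps_ext) (auto simp: fps_X_power_nth le_Suc_eq simp del: power_Suc)
    then show ?case
      using cl_add[OF Suc cl_cmult[OF cl_X]] by metis
  qed
  show ?thesis
    unfolding dense_range_def
  proof (intro ballI allI impI)
    fix F and e :: real
    assume F: "F \<in> H" and e: "e > 0"
    obtain m where m: "N (F - Abs_fps (\<lambda>n. if n \<le> m then fps_nth F n else 0)) < e / 2"
      using truncation_approx[OF F, of "e / 2"] e by auto
    define P where "P = Abs_fps (\<lambda>n. if n \<le> m then fps_nth F n else 0)"
    have P: "cl P"
      unfolding P_def by (rule cl_trunc)
    then obtain U where U: "U \<in> H" "N (P - ?L * U) < e / 2"
      using e unfolding cl_def by (meson half_gt_zero)
    have "F - ?L * U = (F - P) + (P - ?L * U)"
      by simp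
    also have "N \<dots> \<le> N (F - P) + N (P - ?L * U)"
      using P F U unfolding cl_def by (intro N_add H_diff LH) auto
    finally show "\<exists>U\<in>H. N (F - ?L * U) < e"
      using m U by (intro bexI[of _ U]) (auto simp: P_def)
  qed
qed

section \<open>Reduction of density to the zeros in the closed disc\<close>

text \<open>By compactness the absence of zeros extends to a disc of radius \<open>r + e\<close>.
  The formal inverse therefore converges beyond \<open>r\<close>, and \<open>B\<close> is a unit
  acting on \<open>H\<close>.\<close>

lemma dense_range_no_zeros:
  assumes B: "ereal r < fps_conv_radius B" and nz: "\<And>z. z \<in> cball 0 r \<Longrightarrow> eval_fps B z \<noteq> 0"
  shows "dense_range B"
proof -
  have "r \<ge> 0" using r_ge_1 by simp
  let ?W = "{z \<in> eball 0 (fps_conv_radius B). eval_fps B z \<noteq> 0}"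
  have "open ?W"
    using continuous_open_preimage[OF continuous_on_eval_fps open_eball open_delete[OF open_UNIV, of 0], of B]
    by (simp add: vimage_def Int_def)
  moreover have "cball 0 r \<subseteq> ?W"
  proof
    fix z :: complex assume "z \<in> cball 0 r"
    moreover from this have "ereal (norm z) < fps_conv_radius B"
      using B by (metis dist_0_norm ereal_less_eq(3) mem_cball order_le_less_trans)
    ultimately show "z \<in> ?W"
      using nz by simp
  qed
  ultimately obtain e where e: "e > 0" "(\<Union>x\<in>cball 0 r. ball x e) \<subseteq> ?W"
    using compact_subset_open_imp_ball_epsilon_subset[of "cball (0::complex) r"] by auto
  have nz': "eval_fps B z \<noteq> 0" if "norm z < r + e" for z
  proof -
    have "z \<in> (\<Union>x\<in>cball 0 r. ball x e)"
    proof (cases "norm z \<le> r")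
      case True
      then show ?thesis using e by force
    next
      case False
      \<comment> \<open>Radial projection of \<open>z\<close> to the circle of radius
        \<open>r\<close>, at distance \<open>norm z - r < e\<close>.\<close>
      define x where "x = complex_of_real (r / norm z) * z"
      have nz0: "z \<noteq> 0"
        using False \<open>r \<ge> 0\<close> by auto
      have "norm x = r"
        using nz0 \<open>r \<ge> 0\<close> by (simp add: x_def norm_mult norm_divide)
      moreover have "x - z = complex_of_real (r / norm z - 1) * z"
        by (simp add: x_def algebra_simps)
      then have "dist x z = \<bar>r / norm z - 1\<bar> * norm z"
        by (simp only: dist_norm norm_mult norm_of_real)
      moreover have "\<dots> = norm z - r"
        using nz0 False \<open>r \<ge> 0\<close> by (simp add: abs_if field_simps)
      ultimately show ?thesis
        using that by (intro UN_I[of x]) auto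
    qed
    then show ?thesis using e(2) by blast
  qed
  have "min (ereal (r + e)) (fps_conv_radius B) \<le> fps_conv_radius (inverse B)"
    by (rule fps_conv_radius_inverse) (use nz' in simp)
  moreover have "ereal r < min (ereal (r + e)) (fps_conv_radius B)"
    using e B by simp
  ultimately have "ereal r < fps_conv_radius (inverse B)"
    by (rule less_le_trans[rotated])
  moreover have "fps_nth B 0 \<noteq> 0"
    using nz[of 0] r_ge_1 by (simp add: eval_fps_at_0)
  then have "B * inverse B = 1"
    by (simp add: inverse_mult_eq_1')
  ultimately show ?thesis
    by (rule dense_range_unit[rotated])
qed

lemma finite_zeros:
  fixes B :: "complex fps"
  assumes B: "ereal r < fps_conv_radius B" "B \<noteq> 0"
  shows "finite {z \<in> cball 0 r. eval_fps B z = 0}"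
\<comment> \<open>A zero excludes that \<open>B\<close> is constant; without one, \<open>B\<close>
  may be a nonzero constant but the set is empty.\<close>
proof (cases "\<exists>z\<in>cball 0 r. eval_fps B z = 0")
  case True
  let ?S = "eball (0::complex) (fps_conv_radius B)"
  have sub: "cball 0 r \<subseteq> ?S"
    using B(1) by (auto intro: order_le_less_trans[OF iffD2[OF ereal_less_eq(3)]])
  then have "\<not> eval_fps B constant_on ?S"
    using True B(2) by (intro notI) (auto dest!: eval_fps_nonconstant[rotated 2])
  moreover have "eval_fps B holomorphic_on ?S"
    by (intro holomorphic_intros) auto
  ultimately show ?thesis
    using sub by (intro holomorphic_compact_finite_zeros[of _ ?S]) auto
next
  case False
  then have "{z \<in> cball 0 r. eval_fps B z = 0} = {}"
    by auto
  then show ?thesis by (simp only: finite.emptyI)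
qed

text \<open>Induction on the number of zeros in the disc. Dividing by the full power of
  \<open>X - z\<close> leaves a cofactor that is nonzero at \<open>z\<close> and gains no zeros, so
  the count drops.\<close>

lemma dense_range_zeros:
  assumes B: "ereal r < fps_conv_radius B" "B \<noteq> 0"
    and zeros: "\<And>z. z \<in> cball 0 r \<Longrightarrow> eval_fps B z = 0 \<Longrightarrow> dense_range (fps_X - fps_const z)"
  shows "dense_range B"
  using assms
proof (induction "card {z \<in> cball 0 r. eval_fps B z = 0}" arbitrary: B rule: less_induct)
  case less
  let ?Z = "\<lambda>B. {z \<in> cball 0 r. eval_fps B z = 0}"
  show ?case
  proof (cases "?Z B = {}")
    case True
    then show ?thesis
      using less.prems(1) by (intro dense_range_no_zeros) auto
  next
    case False
    then obtain z where z: "norm z \<le> r" "eval_fps B z = 0"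
      by auto
    have radius: "ereal (norm w) < fps_conv_radius B" if "norm w \<le> r" for w :: complex
      using less.prems(1) that by (metis ereal_less_eq(3) order_le_less_trans)
    obtain n G where G: "n > 0" "B = (fps_X - fps_const z) ^ n * G"
      "fps_conv_radius G \<ge> fps_conv_radius B" "eval_fps G z \<noteq> 0"
      using fps_factor_out_zero[OF less.prems(2) radius[OF z(1)] z(2)] by metis
    have eval: "eval_fps B w = (w - z) ^ n * eval_fps G w" if "norm w \<le> r" for w
      unfolding G(2) using radius[OF that] G(3)
      by (subst eval_fps_mult) (auto simp: eval_fps_power eval_fps_diff intro: less_le_trans)
    have "?Z G \<subseteq> ?Z B"
      using eval by auto
    moreover have "z \<in> ?Z B" "z \<notin> ?Z G"
      using z G by auto
    ultimately have "card (?Z G) < card (?Z B)"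
      by (intro psubset_card_mono finite_zeros less.prems) auto
    then have "dense_range G"
    proof (rule less.hyps)
      show "ereal r < fps_conv_radius G"
        using less.prems(1) G(3) by (rule less_le_trans)
      show "G \<noteq> 0"
        using less.prems(2) G(2) by auto
      show "dense_range (fps_X - fps_const w)" if "w \<in> cball 0 r" "eval_fps G w = 0" for w
        using that eval less.prems(3) by auto
    qed
    moreover have "dense_range ((fps_X - fps_const z) ^ n)"
      using z less.prems(3) by (intro dense_range_power) auto
    moreover have "ereal r < fps_conv_radius ((fps_X - fps_const z) ^ n)"
      by simp
    moreover have "ereal r < fps_conv_radius G"
      using less.prems(1) G(3) by (rule less_le_trans)
    ultimately show ?thesis
      unfolding G(2) by (intro dense_range_mult)
  qed
qed

section \<open>Functionals that annihilate a range\<close>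

text \<open>For every \<open>U\<close> the value of \<open>f\<close> at \<open>F\<close> equals its
  value at \<open>F - B * U\<close>, which continuity makes arbitrarily small. Later this serves to
  refute density by exhibiting a nonzero annihilator.\<close>

lemma dense_range_imp_functional_eq_0:
  assumes B: "ereal r < fps_conv_radius B" "dense_range B"
    and f: "f \<in> cont_dual (hahn d) (hahn_norm d)"
    and ann: "\<And>F. F \<in> H \<Longrightarrow> f (fps_nth (B * F)) = 0"
  shows "f x = 0"
proof (cases "x \<in> hahn d")
  case False
  then show ?thesis
    using cont_dual_outside[OF f] by simp
next
  case True
  define F where "F = Abs_fps x"
  have F: "F \<in> H" and x: "x = fps_nth F"
    using True by (simp_all add: F_def fps_nth_Abs_fps_fun)
  obtain BH: "\<And>F. F \<in> H \<Longrightarrow> B * F \<in> H"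
    using fps_mult_bounded[OF B(1)] by blast
  obtain C where C: "\<And>x. x \<in> hahn d \<Longrightarrow> cmod (f x) \<le> C * hahn_norm d x"
    using cont_dual_bound[OF f] by blast
  have "cmod (f x) \<le> e" if e: "e > 0" for e
  proof -
    \<comment> \<open>The constant \<open>C\<close> in the bound may be 0 or negative, so
      \<open>\<bar>C\<bar> + 1\<close> replaces it.\<close>
    have "e / (\<bar>C\<bar> + 1) > 0"
      using e by (simp add: add_nonneg_pos)
    then obtain U where U: "U \<in> H" "N (F - B * U) < e / (\<bar>C\<bar> + 1)"
      using B(2) F unfolding dense_range_def by meson
    have "f (\<lambda>n. fps_nth (F - B * U) n + fps_nth (B * U) n)
        = f (fps_nth (F - B * U)) + f (fps_nth (B * U))"
      using H_diff[OF F BH[OF U(1)]] BH[OF U(1)] by (intro cont_dual_add[OF f]) (simp_all only: mem_Collect_eq)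
    then have "f x = f (fps_nth (F - B * U))"
      using ann[OF U(1)] by (simp add: x)
    also have "cmod \<dots> \<le> C * N (F - B * U)"
      using C H_diff[OF F BH[OF U(1)]] by (simp add: N_def)
    also have "\<dots> \<le> (\<bar>C\<bar> + 1) * N (F - B * U)"
      using N_nonneg by (intro mult_right_mono) auto
    also have "\<dots> \<le> e"
      using U(2) add_nonneg_pos[of "\<bar>C\<bar>" 1] by (simp add: field_simps)
    finally show ?thesis .
  qed
  then have "cmod (f x) \<le> 0"
    by (metis field_le_epsilon add_0)
  then show ?thesis by simp
qed

lemma evaluation_functional:
  assumes Y: "\<And>k. cmod (\<Sum>i\<le>k. z ^ i) \<le> C * d k"
  obtains f where "f \<in> cont_dual (hahn d) (hahn_norm d)" "f (fps_nth 1) = 1"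
    "\<And>F. F \<in> H \<Longrightarrow> f (fps_nth ((fps_X - fps_const z) * F)) = 0"
proof -
  define Y where "Y k = (\<Sum>i\<le>k. z ^ i)" for k
  have Y_Suc: "Y (Suc k) = 1 + z * Y k" for k
    unfolding Y_def sum.atMost_Suc_shift by (simp add: sum_distrib_left)
  \<comment> \<open>Summation by parts turns \<open>\<Sum> x\<^sub>k z\<^sup>k\<close> into an absolutely convergent series.\<close>
  define f where "f x = (if x \<in> hahn d then \<Sum>k. (x k - x (Suc k)) * Y k else 0)" for x
  have bound: "cmod ((x k - x (Suc k)) * Y k) \<le> C * (d k * cmod (x k - x (Suc k)))" for x k
    using mult_left_mono[OF Y[of k], of "cmod (x k - x (Suc k))"]
    by (simp add: norm_mult Y_def mult_ac)
  have summ: "summable (\<lambda>k. C * (d k * cmod (x k - x (Suc k))))" if "x \<in> hahn d" for x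
    using that by (intro summable_mult) (simp add: hahn_def)
  have sums: "(\<lambda>k. (x k - x (Suc k)) * Y k) sums f x" if "x \<in> hahn d" for x
    using summable_comparison_test'[OF summ[OF that] bound] that
    by (simp add: f_def summable_sums)
  have "f (\<lambda>i. x i + y i) = f x + f y" if "x \<in> hahn d" "y \<in> hahn d" for x y
    by (rule sums_unique2[OF sums[OF hahn_add(1)[OF pos_d that]]])
      (use sums_add[OF sums[OF that(1)] sums[OF that(2)]] in \<open>simp add: algebra_simps\<close>)
  moreover have "f (\<lambda>i. c * x i) = c * f x" if "x \<in> hahn d" for c x
    by (rule sums_unique2[OF sums[OF hahn_scale(1)[OF that]]])
      (use sums_mult[OF sums[OF that], of c] in \<open>simp add: algebra_simps\<close>)
  moreover have "cmod (f x) \<le> C * hahn_norm d x" if x: "x \<in> hahn d" for x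
  proof -
    have "cmod (f x) \<le> (\<Sum>k. cmod ((x k - x (Suc k)) * Y k))"
      unfolding f_def using x summable_comparison_test'[OF summ[OF x], of 0 "\<lambda>k. cmod ((x k - x (Suc k)) * Y k)"] bound
      by (simp add: summable_norm)
    also have "\<dots> \<le> (\<Sum>k. C * (d k * cmod (x k - x (Suc k))))"
      by (intro suminf_le bound summ x summable_comparison_test'[OF summ[OF x], of 0])
        (use bound in simp)
    also have "\<dots> = C * hahn_norm d x"
      using x by (simp add: hahn_norm_def hahn_def suminf_mult)
    finally show ?thesis .
  qed
  moreover have "f x = 0" if "x \<notin> hahn d" for x
    using that by (simp add: f_def)
  ultimately have dual: "f \<in> cont_dual (hahn d) (hahn_norm d)"
    by (intro cont_dualI)
  have "f (fps_nth 1) = 1"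
  proof (rule sums_unique2[OF sums])
    show "fps_nth 1 \<in> hahn d"
      using one_H by simp
    have "(\<lambda>k. (fps_nth 1 k - fps_nth 1 (Suc k)) * Y k) sums (\<Sum>k\<in>{0}. (fps_nth 1 k - fps_nth 1 (Suc k)) * Y k)"
      by (rule sums_finite) auto
    then show "(\<lambda>k. (fps_nth 1 k - fps_nth 1 (Suc k)) * Y k) sums 1"
      by (simp add: Y_def)
  qed
  moreover have "f (fps_nth ((fps_X - fps_const z) * F)) = 0" if F: "F \<in> H" for F
  proof (rule sums_unique2[OF sums])
    show "fps_nth ((fps_X - fps_const z) * F) \<in> hahn d"
      using fps_mult_bounded[of "fps_X - fps_const z"] F by auto
    let ?u = "\<lambda>k. fps_nth F k - fps_nth F (Suc k)"
    let ?v = "\<lambda>k. (fps_nth (fps_X * F) k - fps_nth (fps_X * F) (Suc k)) * Y k"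
    have f: "(\<lambda>k. ?u k * Y k) sums f (fps_nth F)"
      using F by (intro sums) simp
    have "?u sums (fps_nth F 0 - 0)"
      by (rule telescope_sums'[OF H_tendsto[OF F]])
    then have "(\<lambda>k. ?u k + z * (?u k * Y k)) sums (fps_nth F 0 + z * f (fps_nth F))"
      by (intro sums_add sums_mult f) simp
    then have "(\<lambda>k. ?v (Suc k)) sums (fps_nth F 0 + z * f (fps_nth F))"
      by (simp add: Y_Suc algebra_simps)
    \<comment> \<open>The term of \<open>?v\<close> at index 0 is minus the constant coefficient of
      \<open>F\<close>, because \<open>X * F\<close> has none and \<open>Y 0 = 1\<close>; it cancels
      the telescoped sum. What remains says that \<open>f\<close> turns multiplication by
      \<open>X\<close> into multiplication by \<open>z\<close>.\<close>
    then have "?v sums (z * f (fps_nth F))"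
      by (subst (asm) sums_Suc_iff) (simp add: Y_def)
    from sums_diff[OF this sums_mult[OF f, of z]]
    show "(\<lambda>k. (fps_nth ((fps_X - fps_const z) * F) k - fps_nth ((fps_X - fps_const z) * F) (Suc k)) * Y k) sums 0"
      by (simp add: algebra_simps)
  qed
  ultimately show thesis
    using that dual by blast
qed

section \<open>The spectra in terms of density and eigenfunctionals\<close>

lemma shift_conv_op:
  "shift_op (conv_op a) l (fps_nth F) = fps_nth ((Abs_fps a - fps_const l) * F)"
  by (simp add: shift_op_def conv_op_eq_fps_mult fps_nth_inverse fun_eq_iff left_diff_distrib)

lemma image_hahn: "g ` hahn d = (\<lambda>F. g (fps_nth F)) ` H"
proof (rule set_eqI)
  fix y
  show "y \<in> g ` hahn d \<longleftrightarrow> y \<in> (\<lambda>F. g (fps_nth F)) ` H"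
    by (auto intro!: image_eqI[of _ _ "Abs_fps _"] simp: fps_nth_Abs_fps_fun)
qed

lemma ball_hahn: "(\<forall>x\<in>hahn d. P x) \<longleftrightarrow> (\<forall>F\<in>H. P (fps_nth F))"
proof
  assume P: "\<forall>F\<in>H. P (fps_nth F)"
  show "\<forall>x\<in>hahn d. P x"
  proof
    fix x assume "x \<in> hahn d"
    then show "P x"
      using bspec[OF P, of "Abs_fps x"] by (simp add: fps_nth_Abs_fps_fun)
  qed
qed simp

lemma closure_range_eq_iff:
  assumes B: "ereal r < fps_conv_radius (Abs_fps a - fps_const l)"
  shows "norm_topology (hahn d) (hahn_norm d) closure_of (shift_op (conv_op a) l ` hahn d) = hahn d
    \<longleftrightarrow> dense_range (Abs_fps a - fps_const l)"
proof -
  let ?B = "Abs_fps a - fps_const l"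
  interpret M: Metric_space "hahn d" "\<lambda>x y. hahn_norm d (\<lambda>n. x n - y n)"
    by (rule Metric_space_hahn[OF pos_d])
  obtain BH: "\<And>F. F \<in> H \<Longrightarrow> ?B * F \<in> H"
    using fps_mult_bounded[OF B] by blast
  have range: "shift_op (conv_op a) l ` hahn d = (\<lambda>F. fps_nth (?B * F)) ` H"
    unfolding image_hahn shift_conv_op ..
  have N: "hahn_norm d (\<lambda>n. fps_nth F n - fps_nth G n) = N (F - G)" for F G
    by (simp add: N_def fps_sub_nth[abs_def])
  have "norm_topology (hahn d) (hahn_norm d) closure_of (shift_op (conv_op a) l ` hahn d) = hahn d
    \<longleftrightarrow> (\<forall>x\<in>hahn d. \<forall>e>0. \<exists>y\<in>(\<lambda>F. fps_nth (?B * F)) ` H. y \<in> M.mball x e)"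
    unfolding norm_topology_def M.metric_closure_of range by blast
  also have "\<dots> \<longleftrightarrow> (\<forall>F\<in>H. \<forall>e>0. \<exists>U\<in>H. fps_nth (?B * U) \<in> M.mball (fps_nth F) e)"
    unfolding ball_hahn by blast
  also have "\<dots> \<longleftrightarrow> dense_range ?B"
    unfolding dense_range_def M.in_mball N using BH by (intro ball_cong refl) auto
  finally show ?thesis .
qed

text \<open>Subtracting \<open>l\<close> alters only the constant coefficient, so the coefficient
  \<open>a 1\<close> keeps the symbol nonzero for every \<open>l\<close>, and a nonzero factor
  cancels in an integral domain.\<close>

lemma inj_on_shift_conv_op:
  assumes "a 1 \<noteq> 0"
  shows "inj_on (shift_op (conv_op a) l) (hahn d)"
proof (rule inj_onI)
  fix x y assume eq: "shift_op (conv_op a) l x = shift_op (conv_op a) l y"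
  let ?B = "Abs_fps a - fps_const l"
  have "fps_nth ?B 1 \<noteq> 0"
    using assms by simp
  then have "?B \<noteq> 0"
    by force
  moreover have "shift_op (conv_op a) l u = fps_nth (?B * Abs_fps u)" for u
    using shift_conv_op[of a l "Abs_fps u"] by (simp add: Abs_fps_inverse)
  then have "?B * Abs_fps x = ?B * Abs_fps y"
    using eq by (simp add: fps_nth_inject)
  ultimately have "Abs_fps x = Abs_fps y"
    by simp
  then show "x = y"
    by (simp add: Abs_fps_inject)
qed

text \<open>By linearity, two functionals with the same image differ by an eigenfunctional. Outside
  \<open>hahn d\<close> every dual element vanishes, so the eigenvalue equation has content only on
  \<open>H\<close>.\<close>

lemma point_spectrum_adjoint_iff:
  "l \<in> point_spectrum (cont_dual (hahn d) (hahn_norm d)) (adjoint_op (hahn d) (conv_op a))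
    \<longleftrightarrow> (\<exists>f\<in>cont_dual (hahn d) (hahn_norm d). (\<exists>x. f x \<noteq> 0) \<and>
          (\<forall>F\<in>H. f (fps_nth (Abs_fps a * F)) = l * f (fps_nth F)))"
  (is "_ \<longleftrightarrow> (\<exists>f\<in>?D. _ \<and> ?ev f)")
proof -
  let ?S = "shift_op (adjoint_op (hahn d) (conv_op a)) l"
  have S: "?S f x = (if x \<in> hahn d then f (fps_nth (Abs_fps a * Abs_fps x)) - l * f x else - l * f x)" for f x
    by (simp add: shift_op_def adjoint_op_def conv_op_eq_fps_mult)
  have zero: "(\<lambda>_. 0) \<in> ?D"
    by (auto simp: cont_dual_def intro!: exI[of _ 0])
  show ?thesis
  proof
    assume "l \<in> point_spectrum ?D (adjoint_op (hahn d) (conv_op a))"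
    then obtain f g where fg: "f \<in> ?D" "g \<in> ?D" "?S f = ?S g" "f \<noteq> g"
      unfolding point_spectrum_def inj_on_def by blast
    define h where "h x = f x - g x" for x
    obtain C where C: "\<And>x. x \<in> hahn d \<Longrightarrow> cmod (f x) \<le> C * hahn_norm d x"
      using cont_dual_bound[OF fg(1)] by blast
    obtain C' where C': "\<And>x. x \<in> hahn d \<Longrightarrow> cmod (g x) \<le> C' * hahn_norm d x"
      using cont_dual_bound[OF fg(2)] by blast
    have "cmod (h x) \<le> (C + C') * hahn_norm d x" if "x \<in> hahn d" for x
      using norm_triangle_ineq4[of "f x" "g x"] C[OF that] C'[OF that]
      by (simp add: h_def algebra_simps)
    then have "h \<in> ?D"
      using fg(1,2)
      by (intro cont_dualI[where C = "C + C'"])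
        (auto simp: h_def cont_dual_outside cont_dual_add cont_dual_scale algebra_simps)
    moreover have "\<exists>x. h x \<noteq> 0"
      using fg(4) by (auto simp: h_def fun_eq_iff)
    moreover have "h (fps_nth (Abs_fps a * F)) = l * h (fps_nth F)" if "F \<in> H" for F
      using fun_cong[OF fg(3), of "fps_nth F"] that
      by (simp add: S h_def fps_nth_inverse algebra_simps)
    ultimately show "\<exists>f\<in>?D. (\<exists>x. f x \<noteq> 0) \<and> ?ev f"
      by blast
  next
    assume "\<exists>f\<in>?D. (\<exists>x. f x \<noteq> 0) \<and> ?ev f"
    then obtain f where f: "f \<in> ?D" "\<exists>x. f x \<noteq> 0" "?ev f"
      by blast
    have "f (fps_nth (Abs_fps a * Abs_fps x)) = l * f x" if "x \<in> hahn d" for x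
      using bspec[OF f(3), of "Abs_fps x"] that by (simp add: fps_nth_Abs_fps_fun)
    moreover have "f x = 0" if "x \<notin> hahn d" for x
      using f(1) that by (rule cont_dual_outside)
    ultimately have "?S f = ?S (\<lambda>_. 0)"
      by (auto simp: S fun_eq_iff)
    then show "l \<in> point_spectrum ?D (adjoint_op (hahn d) (conv_op a))"
      using f zero unfolding point_spectrum_def inj_on_def by (auto simp: fun_eq_iff)
  qed
qed

text \<open>Both spectra are shown to consist of the \<open>l\<close> for which the range of
  multiplication by \<open>?B l\<close> is not dense. If \<open>l\<close> is no value on
  \<open>G\<close>, all zeros of \<open>?B l\<close> in the closed disc are bad and the range is
  dense; if \<open>l\<close> is the value at some \<open>z\<close> in \<open>G\<close>, evaluation
  at \<open>z\<close> annihilates the range.\<close>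

theorem spectra_conv_op:
  fixes a :: "nat \<Rightarrow> complex" and G :: "complex set"
  assumes radius: "ereal r < fps_conv_radius (Abs_fps a)"
    and a1: "a 1 \<noteq> 0"
    and G: "G \<subseteq> cball 0 r"
    and good: "\<And>z. z \<in> G \<Longrightarrow> \<exists>C. \<forall>k. cmod (\<Sum>i\<le>k. z ^ i) \<le> C * d k"
    and bad: "\<And>z e. z \<in> cball 0 r - G \<Longrightarrow> e > 0 \<Longrightarrow> \<exists>U\<in>H. N (1 - (fps_X - fps_const z) * U) < e"
  shows "residual_spectrum (hahn d) (hahn_norm d) (conv_op a) = power_series a ` G"
    and "point_spectrum (cont_dual (hahn d) (hahn_norm d)) (adjoint_op (hahn d) (conv_op a))
          = power_series a ` G"
proof -
  let ?B = "\<lambda>l. Abs_fps a - fps_const l"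
  let ?D = "cont_dual (hahn d) (hahn_norm d)"
  have B: "ereal r < fps_conv_radius (?B l)" for l
    using radius fps_conv_radius_diff[of "Abs_fps a" "fps_const l"] by auto
  have Bnz: "?B l \<noteq> 0" for l
  proof -
    have "fps_nth (?B l) 1 \<noteq> 0"
      using a1 by simp
    then show ?thesis by force
  qed
  have rad: "ereal (norm z) < R" if "z \<in> cball 0 r" "ereal r < R" for z :: complex and R
    using that by (auto intro: order_le_less_trans[OF iffD2[OF ereal_less_eq(3)]])
  have eval: "eval_fps (?B l) z = power_series a z - l" if "z \<in> cball 0 r" for z l
    using rad[OF that radius] by (simp add: eval_fps_diff) (simp add: eval_fps_def power_series_def)
  have dense: "dense_range (?B l)" if l: "l \<notin> power_series a ` G" for l
  proof (rule dense_range_zeros[OF B Bnz])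
    fix z :: complex assume z: "z \<in> cball 0 r" "eval_fps (?B l) z = 0"
    then have "z \<notin> G"
      using l eval by auto
    then show "dense_range (fps_X - fps_const z)"
      using z bad by (intro dense_range_linear) auto
  qed
  have functional: "\<exists>f\<in>?D. f (fps_nth 1) = 1 \<and> (\<forall>F\<in>H. f (fps_nth (?B l * F)) = 0)"
    if l: "l \<in> power_series a ` G" for l
  proof -
    obtain z where z: "z \<in> G" "l = power_series a z"
      using l by auto
    then have zr: "z \<in> cball 0 r"
      using G by auto
    obtain C where "\<And>k. cmod (\<Sum>i\<le>k. z ^ i) \<le> C * d k"
      using good[OF z(1)] by blast
    then obtain f where f: "f \<in> ?D" "f (fps_nth 1) = 1"
      "\<And>F. F \<in> H \<Longrightarrow> f (fps_nth ((fps_X - fps_const z) * F)) = 0"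
      using evaluation_functional[of z C] by metis
    have "eval_fps (?B l) z = 0"
      using eval[OF zr] z by simp
    then obtain n Q where Q: "n > 0" "?B l = (fps_X - fps_const z) ^ n * Q"
      "fps_conv_radius Q \<ge> fps_conv_radius (?B l)"
      using fps_factor_out_zero[OF Bnz rad[OF zr B]] by metis
    define Q' where "Q' = (fps_X - fps_const z) ^ (n - 1) * Q"
    have "?B l = (fps_X - fps_const z) * Q'"
      using Q(1) unfolding Q'_def Q(2) by (cases n) (simp_all add: mult.assoc)
    moreover have "ereal r < fps_conv_radius Q'"
    proof -
      have "fps_conv_radius Q \<le> fps_conv_radius Q'"
        using fps_conv_radius_mult[of "(fps_X - fps_const z) ^ (n - 1)" Q] by (simp add: Q'_def)
      then show ?thesis
        using B[of l] Q(3) by (meson less_le_trans)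
    qed
    then have "Q' * F \<in> H" if "F \<in> H" for F
      using fps_mult_bounded that by blast
    ultimately have "f (fps_nth (?B l * F)) = 0" if "F \<in> H" for F
      using f(3) that by (simp add: mult.assoc)
    with f show ?thesis by blast
  qed
  \<comment> \<open>Being an eigenfunctional of the adjoint for \<open>l\<close> is the same as
    annihilating the range of multiplication by \<open>?B l\<close>.\<close>
  have ann: "f (fps_nth (?B l * F)) = 0 \<longleftrightarrow> f (fps_nth (Abs_fps a * F)) = l * f (fps_nth F)"
    if f: "f \<in> ?D" and F: "F \<in> H" for f F l
  proof -
    have BF: "?B l * F \<in> H"
      using fps_mult_bounded[OF B] F by blast
    have "fps_nth (Abs_fps a * F) = (\<lambda>n. fps_nth (?B l * F) n + fps_nth (fps_const l * F) n)"
      by (simp add: fun_eq_iff algebra_simps)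
    moreover have "f (\<lambda>n. fps_nth (?B l * F) n + fps_nth (fps_const l * F) n)
        = f (fps_nth (?B l * F)) + f (fps_nth (fps_const l * F))"
      using BF H_cmult[OF F] by (intro cont_dual_add[OF f]) (simp_all only: mem_Collect_eq)
    moreover have "f (fps_nth (fps_const l * F)) = l * f (fps_nth F)"
      using F cont_dual_scale[OF f, of "fps_nth F"] by (simp add: fps_mult_left_const_nth[abs_def])
    ultimately show ?thesis by auto
  qed
  have not_dense: "\<not> dense_range (?B l)"
    if "f \<in> ?D" "f x \<noteq> 0" "\<forall>F\<in>H. f (fps_nth (?B l * F)) = 0" for f l x
    using dense_range_imp_functional_eq_0[OF B] that by blast
  have iff: "l \<in> power_series a ` G \<longleftrightarrow> \<not> dense_range (?B l)" for l
    using dense functional not_dense by (metis zero_neq_one)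
  show "residual_spectrum (hahn d) (hahn_norm d) (conv_op a) = power_series a ` G"
    unfolding residual_spectrum_def using iff inj_on_shift_conv_op[of a, OF a1] closure_range_eq_iff[of a, OF B]
    by auto
  have "l \<in> point_spectrum ?D (adjoint_op (hahn d) (conv_op a)) \<longleftrightarrow> l \<in> power_series a ` G" for l
  proof
    assume "l \<in> point_spectrum ?D (adjoint_op (hahn d) (conv_op a))"
    then show "l \<in> power_series a ` G"
      unfolding point_spectrum_adjoint_iff iff using not_dense ann by blast
  next
    assume "l \<in> power_series a ` G"
    then obtain f where f: "f \<in> ?D" "f (fps_nth 1) = 1" "\<forall>F\<in>H. f (fps_nth (?B l * F)) = 0"
      using functional by blast
    then show "l \<in> point_spectrum ?D (adjoint_op (hahn d) (conv_op a))"
      unfolding point_spectrum_adjoint_iff using ann[OF f(1)]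
      by (intro bexI[of _ f] conjI exI[of _ "fps_nth 1"]) auto
  qed
  then show "point_spectrum ?D (adjoint_op (hahn d) (conv_op a)) = power_series a ` G"
    by blast
qed

section \<open>Approximating 1 in the range of a linear factor\<close>

text \<open>The coefficients of \<open>X ^ n\<close> jump only at \<open>n - 1\<close> and
  \<open>n\<close>, and only at \<open>n\<close> if \<open>n = 0\<close>.\<close>

lemma N_X_power_le: "N (fps_X ^ n) \<le> 2 * d n"
proof -
  define g where "g k = d k * cmod (fps_nth (fps_X ^ n) k - fps_nth (fps_X ^ n) (Suc k))" for k
  have N: "N (fps_X ^ n) = (\<Sum>k\<le>n. g k)"
    unfolding g_def by (rule H_finite_support(2)) simp
  show ?thesis
  proof (cases n)
    case 0
    then show ?thesis
      using N pos_d[of 0] by (simp add: g_def)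
  next
    case (Suc m)
    have g: "g k = (if k = m \<or> k = n then d k else 0)" for k
      by (auto simp: g_def Suc fps_X_power_nth simp del: power_Suc)
    have "(\<Sum>k\<le>n. g k) = (\<Sum>k<m. g k) + g m + g n"
      by (simp only: Suc lessThan_Suc_atMost[symmetric] sum.lessThan_Suc)
    also have "(\<Sum>k<m. g k) = 0"
      by (intro sum.neutral) (auto simp: g Suc)
    finally have "N (fps_X ^ n) = d m + d n"
      by (simp add: N g)
    moreover have "d m \<le> d n"
      using mono_d by (simp add: mono_iff_le_Suc Suc)
    ultimately show ?thesis
      by simp
  qed
qed

lemma one_approx_geometric:
  assumes "z \<noteq> 0" and unb: "\<not> bdd_above (range (\<lambda>n. cmod z ^ n / d n))" and e: "e > 0"
  shows "\<exists>U\<in>H. N (1 - (fps_X - fps_const z) * U) < e"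
proof -
  \<comment> \<open>The witness is \<open>U = - (z\<^sup>-\<^sup>1 + z\<^sup>-\<^sup>2 X + \<dots> + z\<^sup>-\<^sup>n X\<^bsup>n-1\<^esup>)\<close>.\<close>
  have ex: "\<exists>U\<in>H. 1 - (fps_X - fps_const z) * U = fps_const (inverse z ^ n) * fps_X ^ n" for n
  proof (induction n)
    case 0
    show ?case
      using zero_H by (intro bexI[of _ 0]) auto
  next
    case (Suc n)
    then obtain U where U: "U \<in> H" "1 - (fps_X - fps_const z) * U = fps_const (inverse z ^ n) * fps_X ^ n"
      by blast
    let ?V = "U + fps_const (- (inverse z ^ Suc n)) * fps_X ^ n"
    have c: "fps_const z * fps_const (inverse z ^ Suc n) = fps_const (inverse z ^ n)"
      using \<open>z \<noteq> 0\<close> by simp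
    have "1 - (fps_X - fps_const z) * ?V
        = (1 - (fps_X - fps_const z) * U) + fps_const (inverse z ^ Suc n) * fps_X ^ Suc n
          - (fps_const z * fps_const (inverse z ^ Suc n)) * fps_X ^ n"
      by (simp add: algebra_simps flip: fps_const_neg del: fps_const_mult)
    also have "\<dots> = fps_const (inverse z ^ Suc n) * fps_X ^ Suc n"
      unfolding c U(2) by simp
    finally show ?case
      using H_add[OF U(1) H_cmult[OF H_X_power]] by blast
  qed
  \<comment> \<open>The remainder has norm at most \<open>2 * d n / cmod z ^ n\<close> by
    \<open>N_X_power_le\<close>, so this \<open>n\<close> brings it below \<open>e\<close>.\<close>
  obtain n where n: "cmod z ^ n / d n > 2 / e"
    using unb by (meson bdd_aboveI2 not_le)
  obtain U where U: "U \<in> H" "1 - (fps_X - fps_const z) * U = fps_const (inverse z ^ n) * fps_X ^ n"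
    using ex by blast
  have "N (1 - (fps_X - fps_const z) * U) = cmod (inverse z ^ n) * N (fps_X ^ n)"
    unfolding U(2) by (rule N_cmult[OF H_X_power])
  also have "\<dots> \<le> cmod (inverse z ^ n) * (2 * d n)"
    by (intro mult_left_mono N_X_power_le) auto
  also have "cmod (inverse z ^ n) = 1 / cmod z ^ n"
    by (simp add: norm_power norm_inverse divide_inverse power_inverse)
  also have "1 / cmod z ^ n * (2 * d n) < e"
    using n e pos_d[of n] \<open>z \<noteq> 0\<close> by (simp add: field_simps)
  finally show ?thesis
    using U(1) by blast
qed

lemma one_approx_Cesaro:
  assumes unb: "\<not> bdd_above (range (\<lambda>n. (real n + 1) / d n))" and e: "e > 0"
  shows "\<exists>U\<in>H. N (1 - (fps_X - fps_const 1) * U) < e"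
proof -
  obtain n where n: "(real n + 1) / d n > 1 / e"
    using unb by (meson bdd_aboveI2 not_le)
  define c where "c = 1 / (of_nat n + 1 :: complex)"
  define A where "A = Abs_fps (\<lambda>k. if k \<le> n then c else 0)"
  \<comment> \<open>\<open>U\<close> solves \<open>(X - 1) U = 1 - A\<close>, where \<open>A\<close> is the mean of \<open>1, X, \<dots>, X\<^sup>n\<close>.\<close>
  define U where "U = Abs_fps (\<lambda>k. if k \<le> n then of_nat (k + 1) * c - 1 else 0)"
  \<comment> \<open>This makes the coefficient of \<open>U\<close> at \<open>n\<close> vanish, so
    that \<open>(X - 1) * U\<close> has no term of degree \<open>n + 1\<close>.\<close>
  have nc: "(of_nat n + 1) * c = 1"
    using of_nat_neq_0[of n, where ?'a = complex] by (simp add: c_def add.commute)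
  have "U \<in> H"
    unfolding U_def by (rule H_finite_support(1)[of n]) simp
  have "fps_nth (1 - (fps_X - fps_const 1) * U) k = fps_nth A k" for k
  proof (cases k)
    case 0
    then show ?thesis by (simp add: A_def U_def left_diff_distrib)
  next
    case (Suc j)
    consider "j < n" | "j = n" | "j > n" by linarith
    then show ?thesis
      using nc by cases (auto simp: Suc A_def U_def algebra_simps)
  qed
  then have "1 - (fps_X - fps_const 1) * U = A"
    by (rule fps_ext)
  \<comment> \<open>The coefficients of \<open>A\<close> are constant up to \<open>n\<close>, so
    only the jump of height \<open>1 / (n + 1)\<close> at \<open>n\<close> counts. Averaging the
    powers thus gains the factor \<open>n + 1\<close> over a single power.\<close>
  moreover have "N A = d n * cmod c"
  proof -
    have "N A = (\<Sum>k\<le>n. d k * cmod (fps_nth A k - fps_nth A (Suc k)))"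
      by (rule H_finite_support(2)) (simp add: A_def)
    also have "\<dots> = (\<Sum>k<n. 0) + d n * cmod c"
      unfolding lessThan_Suc_atMost[symmetric] sum.lessThan_Suc
      by (intro arg_cong2[of _ _ _ _ "(+)"] sum.cong) (auto simp: A_def)
    finally show ?thesis by simp
  qed
  moreover have "cmod c = 1 / (real n + 1)"
    unfolding c_def norm_divide by (metis norm_of_nat norm_one of_nat_Suc add.commute)
  ultimately have "N (1 - (fps_X - fps_const 1) * U) = d n / (real n + 1)"
    by (simp only:) simp
  also have "\<dots> < e"
    using n e pos_d[of n] by (simp add: field_simps)
  finally have "N (1 - (fps_X - fps_const 1) * U) < e" .
  with \<open>U \<in> H\<close> show ?thesis by blast
qed

section \<open>Geometric partial sums compared with the weight\<close>

text \<open>Away from 1 the closed form bounds the sums by \<open>2 / cmod (1 - z)\<close>, and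
  \<open>d k / d 0\<close> is at least 1 by monotonicity.\<close>

lemma geometric_sum_bound_unit_disc:
  assumes "cmod z \<le> 1" "z \<noteq> 1"
  shows "cmod (\<Sum>i\<le>k. z ^ i) \<le> 2 / cmod (1 - z) / d 0 * d k"
proof -
  have "cmod (1 - z ^ Suc k) \<le> 1 + cmod (z ^ Suc k)"
    using norm_triangle_ineq4[of 1 "z ^ Suc k"] by simp
  also have "\<dots> \<le> 2"
    using assms(1) power_le_one[of "cmod z" "Suc k"] by (simp add: norm_power del: power_Suc)
  finally have "cmod (\<Sum>i\<le>k. z ^ i) \<le> 2 / cmod (1 - z)"
    using assms(2) by (simp add: sum_gp0 norm_divide divide_right_mono del: power_Suc)
  also have "\<dots> \<le> 2 / cmod (1 - z) * (d k / d 0)"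
    using mono_d pos_d[of 0] mult_left_mono[of 1 "d k / d 0" "2 / cmod (1 - z)"]
    by (simp add: monoD)
  finally show ?thesis by simp
qed

text \<open>The sum is dominated by that of the powers of \<open>s > 1\<close>, which is at most
  \<open>s / (s - 1)\<close> times its last term. It serves with \<open>s < r\<close> inside the
  disc and with \<open>s = r\<close> on its boundary.\<close>

lemma geometric_sum_bound:
  assumes s: "1 < s" "cmod z \<le> s" and C: "\<And>k. s ^ k \<le> C * d k"
  shows "cmod (\<Sum>i\<le>k. z ^ i) \<le> s / (s - 1) * C * d k"
proof -
  have "cmod (\<Sum>i\<le>k. z ^ i) \<le> (\<Sum>i\<le>k. cmod z ^ i)"
    using norm_sum[of "\<lambda>i. z ^ i" "{..k}"] by (simp add: norm_power)
  also have "\<dots> \<le> (\<Sum>i\<le>k. s ^ i)"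
    using s by (intro sum_mono power_mono) auto
  also have "\<dots> = (s ^ Suc k - 1) / (s - 1)"
    using s sum_gp0[of s k] by (simp add: field_simps)
  also have "\<dots> \<le> s / (s - 1) * s ^ k"
    using s by (simp add: divide_right_mono)
  also have "\<dots> \<le> s / (s - 1) * (C * d k)"
    using s C by (intro mult_left_mono) auto
  finally show ?thesis by (simp add: mult.assoc)
qed

text \<open>Counterpart of \<open>growth\<close> from below: \<open>d n / s ^ n\<close> increases
  from some \<open>M\<close> on, and the factor \<open>s ^ M / d 0\<close> covers the smaller
  indices.\<close>

lemma power_le_weight:
  assumes s: "1 \<le> s" "s < r"
  obtains C where "\<And>k. s ^ k \<le> C * d k"
proof -
  obtain M where M: "\<And>n. n \<ge> M \<Longrightarrow> d (Suc n) / d n > s"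
    using order_tendstoD(1)[OF ratio_d s(2)] by (auto simp: eventually_sequentially)
  have inc: "s ^ k * d M \<le> d (M + k)" for k
  proof (induction k)
    case (Suc k)
    have "s ^ Suc k * d M \<le> s * d (M + k)"
      using Suc s by simp
    also have "\<dots> \<le> d (M + Suc k)"
      using M[of "M + k"] pos_d[of "M + k"] by (simp add: field_simps)
    finally show ?case .
  qed simp
  have "s ^ k \<le> s ^ M / d 0 * d k" for k
  proof (cases "k \<ge> M")
    case True
    have "s ^ (k - M) * d 0 \<le> s ^ (k - M) * d M"
      using s mono_d by (intro mult_left_mono) (auto simp: monoD)
    also have "\<dots> \<le> d k"
      using inc[of "k - M"] True by simp
    finally have "s ^ M * (s ^ (k - M) * d 0) \<le> s ^ M * d k"
      using s by (intro mult_left_mono) auto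
    then show ?thesis
      using True pos_d[of 0] by (simp add: field_simps flip: power_add)
  next
    case False
    have "s ^ k \<le> s ^ M * 1"
      using s False by (simp add: power_increasing)
    also have "\<dots> \<le> s ^ M * (d k / d 0)"
      using s mono_d pos_d[of 0] by (intro mult_left_mono) (auto simp: monoD)
    finally show ?thesis by simp
  qed
  then show thesis by (rule that)
qed

end

section \<open>The cases \<open>r = 1\<close> and \<open>r > 1\<close>\<close>

theorem theorem6p6:
  fixes d :: "nat \<Rightarrow> real" and r :: real and a :: "nat \<Rightarrow> complex"
  assumes "mono d"
    and "\<not> bdd_above (range d)"
    and "\<And>n. 0 < d n"
    and "(\<lambda>n. d (Suc n) / d n) \<longlonglongrightarrow> r"
    and "a 0 \<noteq> 0"
    and "a 1 \<noteq> 0"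
    and "bounded_op (hahn d) (hahn_norm d) (conv_op a)"
    and "\<exists>U. open U \<and> cball 0 r \<subseteq> U \<and> (\<forall>z\<in>U. summable (\<lambda>n. a n * z ^ n))
           \<and> power_series a analytic_on U"
  shows "(r = 1 \<longrightarrow>
      residual_spectrum (hahn d) (hahn_norm d) (conv_op a)
        = point_spectrum (cont_dual (hahn d) (hahn_norm d)) (adjoint_op (hahn d) (conv_op a))
      \<and> point_spectrum (cont_dual (hahn d) (hahn_norm d)) (adjoint_op (hahn d) (conv_op a))
        = (if bdd_above (range (\<lambda>n. (real n + 1) / d n))
           then power_series a ` cball 0 1
           else power_series a ` (cball 0 1 - {1})))
    \<and> (r > 1 \<longrightarrow>
      residual_spectrum (hahn d) (hahn_norm d) (conv_op a)
        = point_spectrum (cont_dual (hahn d) (hahn_norm d)) (adjoint_op (hahn d) (conv_op a))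
      \<and> point_spectrum (cont_dual (hahn d) (hahn_norm d)) (adjoint_op (hahn d) (conv_op a))
        = (if bdd_above (range (\<lambda>n. r ^ n / d n))
           then power_series a ` cball 0 r
           else power_series a ` ball 0 r))"
proof (intro conjI impI)
  assume r: "r = 1"
  interpret hahn_weight d r
    by unfold_locales (use assms r in auto)
  have radius: "ereal r < fps_conv_radius (Abs_fps a)"
    using assms(8) r by (auto intro: fps_conv_radius_gt_of_summable_nhd)
  \<comment> \<open>\<open>G\<close> collects the points whose geometric partial sums are
    \<open>O(d k)\<close>. Only \<open>z = 1\<close> is in doubt, where the sums equal
    \<open>k + 1\<close>.\<close>
  define G where "G = (if bdd_above (range (\<lambda>n. (real n + 1) / d n)) then cball 0 1
    else cball 0 1 - {1 :: complex})"
  have good: "\<exists>C. \<forall>k. cmod (\<Sum>i\<le>k. z ^ i) \<le> C * d k" if z: "z \<in> G" for z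
  proof (cases "z = 1")
    case False
    moreover have "cmod z \<le> 1"
      using z by (auto simp: G_def split: if_splits)
    ultimately show ?thesis
      using geometric_sum_bound_unit_disc[of z] by blast
  next
    case True
    then have "bdd_above (range (\<lambda>n. (real n + 1) / d n))"
      using z by (auto simp: G_def split: if_splits)
    then obtain C where C: "\<And>n. (real n + 1) / d n \<le> C"
      by (auto simp: bdd_above_def)
    have "real n + 1 \<le> C * d n" for n
      using C[of n] pos_d[of n] by (simp add: field_simps)
    moreover have "cmod (\<Sum>i\<le>k. z ^ i) = real k + 1" for k
      unfolding True by (simp add: norm_of_nat[of "Suc k", simplified] del: of_nat_Suc)
    ultimately show ?thesis by auto
  qed
  have bad: "\<exists>U\<in>H. N (1 - (fps_X - fps_const z) * U) < e" if "z \<in> cball 0 r - G" "e > 0" for z e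
    using that r one_approx_Cesaro[of e] by (auto simp: G_def split: if_splits)
  have "G \<subseteq> cball 0 r"
    by (auto simp: G_def r)
  note spectra = spectra_conv_op[OF radius assms(6) this good bad]
  show "residual_spectrum (hahn d) (hahn_norm d) (conv_op a)
        = point_spectrum (cont_dual (hahn d) (hahn_norm d)) (adjoint_op (hahn d) (conv_op a))"
    using spectra by simp
  show "point_spectrum (cont_dual (hahn d) (hahn_norm d)) (adjoint_op (hahn d) (conv_op a))
        = (if bdd_above (range (\<lambda>n. (real n + 1) / d n))
           then power_series a ` cball 0 1
           else power_series a ` (cball 0 1 - {1}))"
    using spectra(2) by (simp add: G_def)
next
  assume r: "r > 1"
  interpret hahn_weight d r
    by unfold_locales (use assms r in auto)
  have radius: "ereal r < fps_conv_radius (Abs_fps a)"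
    using assms(8) r by (auto intro: fps_conv_radius_gt_of_summable_nhd)
  \<comment> \<open>Here the interior is always good, and on the circle the comparison of
    \<open>r ^ n\<close> with \<open>d n\<close> decides for all points at once.\<close>
  define G where "G = (if bdd_above (range (\<lambda>n. r ^ n / d n)) then cball 0 r
    else ball (0 :: complex) r)"
  have good: "\<exists>C. \<forall>k. cmod (\<Sum>i\<le>k. z ^ i) \<le> C * d k" if z: "z \<in> G" for z
  proof (cases "cmod z < r")
    case True
    \<comment> \<open>The midpoint of 1 and \<open>r\<close> keeps \<open>s\<close> above 1 even
      when \<open>cmod z\<close> is at most 1, as \<open>geometric_sum_bound\<close>
      demands.\<close>
    define s where "s = max (cmod z) ((1 + r) / 2)"
    have s: "1 < s" "s < r" "cmod z \<le> s"
      using True r by (auto simp: s_def less_max_iff_disj)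
    obtain C where "\<And>k. s ^ k \<le> C * d k"
      using power_le_weight[of s] s by auto
    then show ?thesis
      using geometric_sum_bound[OF s(1,3)] by blast
  next
    case False
    then have "bdd_above (range (\<lambda>n. r ^ n / d n))" and zr: "cmod z \<le> r"
      using z by (auto simp: G_def split: if_splits)
    then obtain C where C: "\<And>n. r ^ n / d n \<le> C"
      by (auto simp: bdd_above_def)
    have "r ^ n \<le> C * d n" for n
      using C[of n] pos_d[of n] by (simp add: field_simps)
    then show ?thesis
      using geometric_sum_bound[OF r zr] by blast
  qed
  have bad: "\<exists>U\<in>H. N (1 - (fps_X - fps_const z) * U) < e" if "z \<in> cball 0 r - G" "e > 0" for z e
  proof (rule one_approx_geometric)
    have "cmod z = r" "\<not> bdd_above (range (\<lambda>n. r ^ n / d n))"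
      using that by (auto simp: G_def split: if_splits)
    then show "z \<noteq> 0" "\<not> bdd_above (range (\<lambda>n. cmod z ^ n / d n))"
      using r by auto
  qed fact
  have "G \<subseteq> cball 0 r"
    by (auto simp: G_def)
  note spectra = spectra_conv_op[OF radius assms(6) this good bad]
  show "residual_spectrum (hahn d) (hahn_norm d) (conv_op a)
        = point_spectrum (cont_dual (hahn d) (hahn_norm d)) (adjoint_op (hahn d) (conv_op a))"
    using spectra by simp
  show "point_spectrum (cont_dual (hahn d) (hahn_norm d)) (adjoint_op (hahn d) (conv_op a))
        = (if bdd_above (range (\<lambda>n. r ^ n / d n))
           then power_series a ` cball 0 r
           else power_series a ` ball 0 r)"
    using spectra(2) by (simp add: G_def)
qed

end
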